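(* For all $i,j\in\mathbb Z$, $\tilde\theta_i\tilde\theta_j=\tilde\theta_j\tilde\theta_i$ in $\widetilde{FK}_n$.
   Context: Fix $n\ge2$. Let $\mathcal S$ be the set of symbols $[ij]$, $i<j$ integers with $i\not\equiv j\pmod n$; for $i>j$ put $[ij]:=-[ji]$. $\mathcal A$ is the completion of the free algebra on $\mathcal S$ (formal possibly infinite integer combinations of finite words) along the filtration by subalgebras generated by $[ij]$ with $|i|,|j|\ge N$. $\widetilde S_n$ is the affine symmetric group (bijections $w$ of $\mathbb Z$, $w(i+n)=w(i)+n$, $\sum_{i=1}^nw(i)=\sum_{i=1}^n i$) with length $\ell$; $t_{ij}$ swaps $i+rn$, $j+rn$ for all $r$. $\mathbb A$ is the affine nilCoxeter algebra with basis $A_w$; $[ij]$ acts on the right by $A_w\cdot[ij]=A_{wt_{ij}}$ if $\ell(wt_{ij})=\ell(w)-1$, else $0$; $\mathcal E\subset\mathcal A$ consists of elements whose action on each $A_w$ has only finitely many nonzero terms. The affine Fomin–Kirillov algebra $\widetilde{FK}_n$ is the quotient of $\mathcal E$ by the relations: (a) $[ij]^2=0$; (b) $[ij][kl]=[kl][ij]$ if the residues of $i,j,k,l$ mod $n$ are distinct; (c) for $i,j,k$ with distinct residues, $[ij][jk]=[jk][ik]+[ik][ij]$ and $[jk][ij]=[ik][jk]+[ik][ij]$; (d) for $i,j$ with $i\not\equiv j$, $\sum_{i'\equiv i,\,j'\equiv j}[ij'][ji']=0$; (e) $[i,j]=[i+n,j+n]$. The Dunkl element is $\tilde\theta_i=\sum_{j\in\mathbb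 Z,\,j\not\equiv i\pmod n}[ij]$.
   Formalization: The quotient of E is taken by the smallest two-sided ideal containing the relations and closed under infinite sums that act locally finitely on each A_w (with only finite sums the claim fails); it is proved for the second relation (c) both as printed and with last term [ij][ik]. *)

theory Defs
  imports "HOL-Library.Poly_Mapping" "HOL-Number_Theory.Cong" "HOL-Algebra.QuotRing"
begin

section \<open>The affine symmetric group\<close>

definition affine_sym :: "nat \<Rightarrow> (int \<Rightarrow> int) set" where
  "affine_sym n = {w. bij w \<and> (\<forall>i. w (i + int n) = w i + int n) \<and>
     (\<Sum>i=1..int n. w i) = (\<Sum>i=1..int n. i)}"

definition aff_refl :: "nat \<Rightarrow> int \<Rightarrow> int \<Rightarrow> int \<Rightarrow> int" where
  "aff_refl n i j x =
     (if [x = i] (mod int n) then x + (j - i)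
      else if [x = j] (mod int n) then x + (i - j)
      else x)"

text \<open>Coxeter length with respect to the simple reflections
  \<open>s\<^sub>k = t\<^sub>k\<^sub>,\<^sub>k\<^sub>+\<^sub>1\<close>, \<open>0 \<le> k < n\<close>.\<close>

definition aff_length :: "nat \<Rightarrow> (int \<Rightarrow> int) \<Rightarrow> nat" where
  "aff_length n w =
     (LEAST m. \<exists>ks. length ks = m \<and> set ks \<subseteq> {0..<int n} \<and>
        w = foldr (\<lambda>k v. aff_refl n k (k + 1) \<circ> v) ks id)"


section \<open>Formal infinite combinations of words\<close>

text \<open>The letter \<open>(i, j)\<close> with \<open>i < j\<close> is the symbol \<open>[ij]\<close>. A formal, possibly infinite,
  integer combination of words is its coefficient function; a word has only
  finitely many factorisations, so the concatenation product is always defined.\<close>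

type_synonym fk_word = "(int \<times> int) list"
type_synonym fk_elt = "fk_word \<Rightarrow> int"

definition fk_symbols :: "nat \<Rightarrow> (int \<times> int) set" where
  "fk_symbols n = {(i, j). i < j \<and> \<not> [i = j] (mod int n)}"

definition fk_A :: "nat \<Rightarrow> fk_elt set" where
  "fk_A n = {x. \<forall>u. x u \<noteq> 0 \<longrightarrow> u \<in> lists (fk_symbols n)}"

definition fk_zero :: fk_elt where
  "fk_zero = (\<lambda>u. 0)"

definition fk_one :: fk_elt where
  "fk_one = (\<lambda>u. if u = [] then 1 else 0)"

definition fk_add :: "fk_elt \<Rightarrow> fk_elt \<Rightarrow> fk_elt" (infixl \<open>+\<^sub>A\<close> 65) where
  "x +\<^sub>A y = (\<lambda>u. x u + y u)"

definition fk_diff :: "fk_elt \<Rightarrow> fk_elt \<Rightarrow> fk_elt" (infixl \<open>-\<^sub>A\<close> 65) where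
  "x -\<^sub>A y = (\<lambda>u. x u - y u)"

definition fk_mult :: "fk_elt \<Rightarrow> fk_elt \<Rightarrow> fk_elt" (infixl \<open>*\<^sub>A\<close> 70) where
  "x *\<^sub>A y = (\<lambda>u. \<Sum>k\<le>length u. x (take k u) * y (drop k u))"

definition br :: "int \<Rightarrow> int \<Rightarrow> fk_elt" where
  "br i j = (\<lambda>u. if i < j then (if u = [(i, j)] then 1 else 0)
                 else (if u = [(j, i)] then - 1 else 0))"

text \<open>Formal sum of a family in which every word occurs only finitely often.\<close>

definition formal_sum :: "'k set \<Rightarrow> ('k \<Rightarrow> fk_elt) \<Rightarrow> fk_elt" where
  "formal_sum K f = (\<lambda>u. \<Sum>k | k \<in> K \<and> f k u \<noteq> 0. f k u)"


section \<open>Action on the affine nilCoxeter algebra\<close>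

text \<open>Only the underlying free abelian group of the nilCoxeter algebra matters here; its basis
  element \<open>A\<^sub>w\<close> is \<open>frag_of w\<close>. Since \<open>[ij]\<close> acts from the right, the leftmost letter of a
  word acts first.\<close>

definition nc_act_letter ::
    "nat \<Rightarrow> int \<times> int \<Rightarrow> ((int \<Rightarrow> int) \<Rightarrow>\<^sub>0 int) \<Rightarrow> ((int \<Rightarrow> int) \<Rightarrow>\<^sub>0 int)" where
  "nc_act_letter n = (\<lambda>(i, j). frag_extend
     (\<lambda>w. if aff_length n (w \<circ> aff_refl n i j) + 1 = aff_length n w
          then frag_of (w \<circ> aff_refl n i j) else 0))"

definition nc_act_word ::
    "nat \<Rightarrow> fk_word \<Rightarrow> ((int \<Rightarrow> int) \<Rightarrow>\<^sub>0 int) \<Rightarrow> ((int \<Rightarrow> int) \<Rightarrow>\<^sub>0 int)" where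
  "nc_act_word n u a = fold (nc_act_letter n) u a"

definition fk_E :: "nat \<Rightarrow> fk_elt ring" where
  "fk_E n =
     \<lparr>carrier = {x \<in> fk_A n. \<forall>w \<in> affine_sym n.
                   finite {u. x u \<noteq> 0 \<and> nc_act_word n u (frag_of w) \<noteq> 0}},
      mult = (*\<^sub>A), one = fk_one, zero = fk_zero, add = (+\<^sub>A)\<rparr>"


section \<open>The affine Fomin--Kirillov algebra\<close>

definition fk_common_relators :: "nat \<Rightarrow> fk_elt set" where
  "fk_common_relators n =
     {br i j *\<^sub>A br i j | i j. \<not> [i = j] (mod int n)} \<union>
     {br i j *\<^sub>A br k l -\<^sub>A br k l *\<^sub>A br i j | i j k l.
        distinct [i mod int n, j mod int n, k mod int n, l mod int n]} \<union>
     {br i j *\<^sub>A br j k -\<^sub>A (br j k *\<^sub>A br i k +\<^sub>A br i k *\<^sub>A br i j) | i j k.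
        distinct [i mod int n, j mod int n, k mod int n]} \<union>
     {formal_sum {(i', j'). [i' = i] (mod int n) \<and> [j' = j] (mod int n)}
        (\<lambda>(i', j'). br i j' *\<^sub>A br j i') | i j. \<not> [i = j] (mod int n)} \<union>
     {br i j -\<^sub>A br (i + int n) (j + int n) | i j. \<not> [i = j] (mod int n)}"

text \<open>The second three-term relation is the mirror image
  \<open>[jk][ij] = [ik][jk] + [ij][ik]\<close> of the first one, exactly as in the finite
  Fomin--Kirillov algebra, and it annihilates the nilCoxeter algebra. It is also found in print
  with last term \<open>[ik][ij]\<close>; together with the first relation this forces
  \<open>[ij][ik] = [ik][ij]\<close>, which fails on the nilCoxeter algebra. Both versions are provided.\<close>

definition fk_relators :: "nat \<Rightarrow> fk_elt set" where
  "fk_relators n = fk_common_relators n \<union>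
     {br j k *\<^sub>A br i j -\<^sub>A (br i k *\<^sub>A br j k +\<^sub>A br i j *\<^sub>A br i k) | i j k.
        distinct [i mod int n, j mod int n, k mod int n]}"

definition fk_relators_printed :: "nat \<Rightarrow> fk_elt set" where
  "fk_relators_printed n = fk_common_relators n \<union>
     {br j k *\<^sub>A br i j -\<^sub>A (br i k *\<^sub>A br j k +\<^sub>A br i k *\<^sub>A br i j) | i j k.
        distinct [i mod int n, j mod int n, k mod int n]}"

text \<open>A sequence in \<open>fk_E n\<close> is summable if its formal sum exists and
  acts on each \<open>A\<^sub>w\<close> through finitely many members of the sequence. (Arbitrary index sets give
  nothing more, as there are only countably many words.)\<close>

definition fk_summable :: "nat \<Rightarrow> (nat \<Rightarrow> fk_elt) \<Rightarrow> bool" where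
  "fk_summable n f \<longleftrightarrow>
     (\<forall>u. finite {k. f k u \<noteq> 0}) \<and>
     (\<forall>w \<in> affine_sym n. finite {k. \<exists>u. f k u \<noteq> 0 \<and> nc_act_word n u (frag_of w) \<noteq> 0})"

text \<open>The relations are imposed compatibly with the infinite sums that make sense in \<open>fk_E n\<close>:
  the ideal is the least two-sided ideal containing the relators and closed under
  summable sums. Closure for coefficientwise convergence would be too coarse: since
  \<open>[i,j] - [i+mn,j+mn]\<close> tends to \<open>[i,j]\<close> coefficientwise as \<open>m\<close> grows, it would kill
  every symbol. That sequence does not converge here, because \<open>[i+mn,j+mn]\<close> acts in the same
  way for all \<open>m\<close>.\<close>

definition fk_ideal :: "nat \<Rightarrow> fk_elt set \<Rightarrow> fk_elt set" where
  "fk_ideal n R = \<Inter> {I. ideal I (fk_E n) \<and> R \<subseteq> I \<and>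
     (\<forall>f. range f \<subseteq> I \<and> fk_summable n f \<longrightarrow> formal_sum UNIV f \<in> I)}"

definition FK :: "nat \<Rightarrow> fk_elt set \<Rightarrow> fk_elt set ring" where
  "FK n R = fk_E n Quot fk_ideal n R"

definition dunkl :: "nat \<Rightarrow> int \<Rightarrow> fk_elt" where
  "dunkl n i = formal_sum {j. \<not> [j = i] (mod int n)} (br i)"

definition dunkl_class :: "nat \<Rightarrow> fk_elt set \<Rightarrow> int \<Rightarrow> fk_elt set" where
  "dunkl_class n R i = fk_ideal n R +>\<^bsub>fk_E n\<^esub> dunkl n i"


section \<open>Well-definedness\<close>

lemma fk_E_sel:
  "carrier (fk_E n) = {x \<in> fk_A n. \<forall>w \<in> affine_sym n.
                   finite {u. x u \<noteq> 0 \<and> nc_act_word n u (frag_of w) \<noteq> 0}}"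
  "mult (fk_E n) = (*\<^sub>A)" "one (fk_E n) = fk_one" "zero (fk_E n) = fk_zero" "add (fk_E n) = (+\<^sub>A)"
  by (simp_all add: fk_E_def)

lemma aff_refl_shift: "n > 0 \<Longrightarrow> aff_refl n i j (x + int n) = aff_refl n i j x + int n"
  by (auto simp: aff_refl_def cong_def)

lemma aff_refl_invol:
  assumes "\<not> [i = j] (mod int n)" shows "aff_refl n i j (aff_refl n i j x) = x"
proof -
  have 1: "[x + (j - i) = j] (mod int n)" if "[x = i] (mod int n)"
    using that by (metis add.commute cong_add_rcancel diff_add_cancel add_diff_eq)
  have 2: "[x + (i - j) = i] (mod int n)" if "[x = j] (mod int n)"
    using that by (metis add.commute cong_add_rcancel diff_add_cancel add_diff_eq)
  show ?thesis
  proof (cases "[x = i] (mod int n)")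
    case True
    moreover have "\<not> [x + (j - i) = i] (mod int n)" using 1[OF True] assms by (meson cong_sym cong_trans)
    ultimately show ?thesis using 1 by (simp add: aff_refl_def)
  next
    case False
    then show ?thesis using 2 by (auto simp: aff_refl_def)
  qed
qed

lemma aff_shift_mult:
  assumes "\<forall>i. w (i + int n) = w i + int n"
  shows "w (x + k * int n) = w x + k * int n"
proof -
  have nat: "w (y + int m * int n) = w y + int m * int n" for m y
  proof (induction m)
    case (Suc m)
    have "w ((y + int m * int n) + int n) = w (y + int m * int n) + int n" using assms by blast
    then show ?case using Suc by (simp add: algebra_simps)
  qed simp
  show ?thesis
  proof (cases "k \<ge> 0")
    case True then show ?thesis using nat[of x "nat k"] by simp
  next
    case False then show ?thesis using nat[of "x + k * int n" "nat (-k)"] by simp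
  qed
qed

lemma residue_rep:
  assumes "n > 0" obtains a p where "a \<in> {1..int n}" "i = a + p * int n"
proof
  have "(i - 1) mod int n < int n" "(i - 1) mod int n \<ge> 0" using assms by simp_all
  then show "(i - 1) mod int n + 1 \<in> {1..int n}" by simp
  have "(i - 1) mod int n + ((i - 1) div int n) * int n = i - 1" by simp
  then show "i = ((i - 1) mod int n + 1) + ((i - 1) div int n) * int n" by linarith
qed

lemma rep_cong_iff:
  assumes "x \<in> {1..int n}" "a \<in> {1..int n}"
  shows "[x = a + p * int n] (mod int n) \<longleftrightarrow> x = a"
proof
  assume "[x = a + p * int n] (mod int n)"
  then have "int n dvd x - a - p * int n" by (simp add: cong_iff_dvd_diff diff_diff_eq)
  then have "int n dvd (x - a - p * int n) + p * int n" by (rule dvd_add) simp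
  then have "int n dvd x - a" by simp
  moreover have "\<bar>x - a\<bar> < int n" using assms by auto
  ultimately have "x - a = 0" using dvd_imp_le_int[of "x - a" "int n"] by force
  then show "x = a" by simp
next
  assume "x = a" then show "[x = a + p * int n] (mod int n)" by (simp add: cong_def)
qed

lemma affine_sym_refl:
  assumes n: "n > 0" and w: "w \<in> affine_sym n" and ij: "\<not> [i = j] (mod int n)"
  shows "w \<circ> aff_refl n i j \<in> affine_sym n"
proof -
  let ?t = "aff_refl n i j"
  from w have bw: "bij w" and pw: "\<forall>i. w (i + int n) = w i + int n"
    and sw: "(\<Sum>i=1..int n. w i) = (\<Sum>i=1..int n. i)" by (auto simp: affine_sym_def)
  have "bij ?t" using aff_refl_invol[OF ij] by (metis involuntory_imp_bij)
  then have b: "bij (w \<circ> ?t)" using bw by (rule bij_comp)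
  obtain a p where a: "a \<in> {1..int n}" "i = a + p * int n" using residue_rep[OF n] .
  obtain b' q where b': "b' \<in> {1..int n}" "j = b' + q * int n" using residue_rep[OF n] .
  have ab: "a \<noteq> b'" using ij a b' by (auto simp: cong_def)
  have ta: "?t a = b' + (q - p) * int n" using a b' rep_cong_iff[OF a(1) a(1), of p]
    by (simp add: aff_refl_def algebra_simps)
  have tb: "?t b' = a + (p - q) * int n"
    using a b' ab rep_cong_iff[OF b'(1) a(1), of p] rep_cong_iff[OF b'(1) b'(1), of q]
    by (simp add: aff_refl_def algebra_simps)
  have tx: "?t x = x" if "x \<in> {1..int n} - {a} - {b'}" for x
    using that a b' rep_cong_iff[of x n a p] rep_cong_iff[of x n b' q]
    by (auto simp: aff_refl_def)
  have split: "sum f {1..int n} = f a + (f b' + sum f ({1..int n} - {a} - {b'}))" for f :: "int \<Rightarrow> int"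
    using a(1) b'(1) ab by (subst sum.remove[of _ a], simp_all, subst sum.remove[of _ b'], auto)
  have "(\<Sum>x=1..int n. (w \<circ> ?t) x) = (\<Sum>x=1..int n. w x)"
    unfolding split[of "w \<circ> ?t"] split[of w]
    using tx by (simp add: ta tb aff_shift_mult[OF pw])
      (simp add: algebra_simps)
  with b pw sw aff_refl_shift[OF n] show ?thesis by (auto simp: affine_sym_def)
qed

lemma nc_act_letter_0 [simp]: "nc_act_letter n s 0 = 0"
  by (simp add: nc_act_letter_def split: prod.split)

lemma nc_act_word_0 [simp]: "nc_act_word n u 0 = 0"
  unfolding nc_act_word_def by (induction u) auto

lemma nc_act_word_Nil [simp]: "nc_act_word n [] a = a" by (simp add: nc_act_word_def)

lemma nc_act_word_append: "nc_act_word n (u @ v) a = nc_act_word n v (nc_act_word n u a)"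
  by (simp add: nc_act_word_def)

lemma nc_act_word_Cons: "nc_act_word n ((i,j) # v) (frag_of w) =
  (if aff_length n (w \<circ> aff_refl n i j) + 1 = aff_length n w
   then nc_act_word n v (frag_of (w \<circ> aff_refl n i j)) else 0)"
  using nc_act_word_0[of n v] by (simp add: nc_act_word_def nc_act_letter_def)

lemma nc_act_word_basis:
  assumes n: "n > 0" and u: "u \<in> lists (fk_symbols n)"
  shows "w \<in> affine_sym n \<Longrightarrow> nc_act_word n u (frag_of w) \<noteq> 0 \<Longrightarrow>
    \<exists>w' \<in> affine_sym n. nc_act_word n u (frag_of w) = frag_of w'"
  using u
proof (induction u arbitrary: w)
  case (Cons s u)
  then show ?case using affine_sym_refl[OF n, of w "fst s" "snd s"]
    by (cases s) (auto simp: nc_act_word_Cons fk_symbols_def split: if_splits)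
qed auto

lemma fk_mult_assoc: "(x *\<^sub>A y) *\<^sub>A z = x *\<^sub>A (y *\<^sub>A z)"
proof
  fix u
  have "((x *\<^sub>A y) *\<^sub>A z) u = (\<Sum>k\<le>length u. \<Sum>l\<le>k. x (take l u) * y (drop l (take k u)) * z (drop k u))"
    by (auto simp: fk_mult_def sum_distrib_right min_def intro!: sum.cong)
  also have "\<dots> = (\<Sum>(k,l)\<in>Sigma {..length u} (\<lambda>k. {..k}). x (take l u) * y (drop l (take k u)) * z (drop k u))"
    by (subst sum.Sigma) auto
  also have "\<dots> = (\<Sum>(l,m)\<in>Sigma {..length u} (\<lambda>l. {..length u - l}). x (take l u) * y (take m (drop l u)) * z (drop m (drop l u)))"
    by (rule sum.reindex_bij_witness[of _ "\<lambda>(l,m). (l+m, l)" "\<lambda>(k,l). (l, k-l)"])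
       (auto simp: drop_take)
  also have "\<dots> = (\<Sum>l\<le>length u. \<Sum>m\<le>length u - l. x (take l u) * y (take m (drop l u)) * z (drop m (drop l u)))"
    by (subst sum.Sigma) auto
  also have "\<dots> = (x *\<^sub>A (y *\<^sub>A z)) u"
    by (auto simp: fk_mult_def sum_distrib_left mult.assoc intro!: sum.cong)
  finally show "((x *\<^sub>A y) *\<^sub>A z) u = (x *\<^sub>A (y *\<^sub>A z)) u" .
qed

lemma fk_one_mult: "fk_one *\<^sub>A x = x"
proof
  fix u
  have "(fk_one *\<^sub>A x) u = (\<Sum>k\<le>length u. if k = 0 then x u else 0)"
    unfolding fk_mult_def fk_one_def by (rule sum.cong) auto
  then show "(fk_one *\<^sub>A x) u = x u" by simp
qed

lemma fk_mult_one: "x *\<^sub>A fk_one = x"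
proof
  fix u
  have "(x *\<^sub>A fk_one) u = (\<Sum>k\<le>length u. if k = length u then x u else 0)"
    unfolding fk_mult_def fk_one_def by (rule sum.cong) auto
  then show "(x *\<^sub>A fk_one) u = x u" by simp
qed

lemma fk_mult_nz: "(x *\<^sub>A y) u \<noteq> 0 \<Longrightarrow> \<exists>p q. u = p @ q \<and> x p \<noteq> 0 \<and> y q \<noteq> 0"
proof -
  assume "(x *\<^sub>A y) u \<noteq> 0"
  then obtain k where "x (take k u) * y (drop k u) \<noteq> 0"
    unfolding fk_mult_def using sum.not_neutral_contains_not_neutral by blast
  then show ?thesis by (intro exI[of _ "take k u"] exI[of _ "drop k u"]) auto
qed

lemma fk_E_add: "x \<in> carrier (fk_E n) \<Longrightarrow> y \<in> carrier (fk_E n) \<Longrightarrow> x +\<^sub>A y \<in> carrier (fk_E n)"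
proof -
  assume a: "x \<in> carrier (fk_E n)" "y \<in> carrier (fk_E n)"
  have "finite {u. (x +\<^sub>A y) u \<noteq> 0 \<and> nc_act_word n u (frag_of w) \<noteq> 0}" if "w \<in> affine_sym n" for w
    by (rule finite_subset[where B = "{u. x u \<noteq> 0 \<and> nc_act_word n u (frag_of w) \<noteq> 0} \<union> {u. y u \<noteq> 0 \<and> nc_act_word n u (frag_of w) \<noteq> 0}"])
       (use a that in \<open>auto simp: fk_E_sel fk_add_def\<close>)
  moreover have "x +\<^sub>A y \<in> fk_A n" using a unfolding fk_E_sel fk_A_def fk_add_def
    by simp (metis add.right_neutral)
  ultimately show ?thesis by (simp add: fk_E_sel)
qed

lemma fk_E_mult:
  assumes n: "n > 0" and a: "x \<in> carrier (fk_E n)" "y \<in> carrier (fk_E n)"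
  shows "x *\<^sub>A y \<in> carrier (fk_E n)"
proof -
  have "x *\<^sub>A y \<in> fk_A n" using a fk_mult_nz[of x y] by (fastforce simp: fk_E_sel fk_A_def)
  moreover have "finite {u. (x *\<^sub>A y) u \<noteq> 0 \<and> nc_act_word n u (frag_of w) \<noteq> 0}" if w: "w \<in> affine_sym n" for w
  proof -
    let ?X = "{u. x u \<noteq> 0 \<and> nc_act_word n u (frag_of w) \<noteq> 0}"
    let ?Y = "\<lambda>p. {q. y q \<noteq> 0 \<and> nc_act_word n q (nc_act_word n p (frag_of w)) \<noteq> 0}"
    have fX: "finite ?X" using a w by (simp add: fk_E_sel)
    have fY: "finite (?Y p)" if "p \<in> ?X" for p
    proof -
      have "p \<in> lists (fk_symbols n)" using that a by (auto simp: fk_E_sel fk_A_def)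
      then obtain w' where "w' \<in> affine_sym n" "nc_act_word n p (frag_of w) = frag_of w'"
        using nc_act_word_basis[OF n _ w] \<open>p \<in> ?X\<close> by blast
      then show ?thesis using a by (simp add: fk_E_sel)
    qed
    have "{u. (x *\<^sub>A y) u \<noteq> 0 \<and> nc_act_word n u (frag_of w) \<noteq> 0} \<subseteq> (\<Union>p\<in>?X. (\<lambda>q. p @ q) ` ?Y p)"
    proof
      fix u assume u: "u \<in> {u. (x *\<^sub>A y) u \<noteq> 0 \<and> nc_act_word n u (frag_of w) \<noteq> 0}"
      then obtain p q where pq: "u = p @ q" "x p \<noteq> 0" "y q \<noteq> 0" using fk_mult_nz by blast
      then have "nc_act_word n q (nc_act_word n p (frag_of w)) \<noteq> 0" using u by (simp add: nc_act_word_append)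
      moreover from this have "nc_act_word n p (frag_of w) \<noteq> 0" by auto
      ultimately show "u \<in> (\<Union>p\<in>?X. (\<lambda>q. p @ q) ` ?Y p)" using pq by blast
    qed
    then show ?thesis using fX fY by (meson finite_UN_I finite_imageI finite_subset)
  qed
  ultimately show ?thesis by (simp add: fk_E_sel)
qed

lemma fk_finsupp_E: "x \<in> fk_A n \<Longrightarrow> finite {u. x u \<noteq> 0} \<Longrightarrow> x \<in> carrier (fk_E n)"
  by (simp add: fk_E_sel)

lemma fk_one_E: "fk_one \<in> carrier (fk_E n)"
  by (rule fk_finsupp_E) (auto simp: fk_one_def fk_A_def)

lemma fk_zero_E: "fk_zero \<in> carrier (fk_E n)"
  by (rule fk_finsupp_E) (auto simp: fk_zero_def fk_A_def)

lemma fk_uminus_E: "x \<in> carrier (fk_E n) \<Longrightarrow> (\<lambda>u. - x u) \<in> carrier (fk_E n)"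
  by (auto simp: fk_E_sel fk_A_def)

lemma fk_distrib: "(x +\<^sub>A y) *\<^sub>A z = x *\<^sub>A z +\<^sub>A y *\<^sub>A z" "z *\<^sub>A (x +\<^sub>A y) = z *\<^sub>A x +\<^sub>A z *\<^sub>A y"
  by (simp_all add: fk_mult_def fk_add_def sum.distrib distrib_left distrib_right)

lemma fk_add_assoc: "(x +\<^sub>A y) +\<^sub>A z = x +\<^sub>A (y +\<^sub>A z)"
  by (simp add: fk_add_def add.assoc)

lemma fk_add_commute: "x +\<^sub>A y = y +\<^sub>A x"
  by (simp add: fk_add_def add.commute)

lemma fk_zero_add: "fk_zero +\<^sub>A x = x"
  by (simp add: fk_add_def fk_zero_def)

lemma ring_fk_E: assumes n: "n > 0" shows "ring (fk_E n)"
proof (rule ringI)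
  show "abelian_group (fk_E n)"
  proof (rule abelian_groupI)
    fix x assume "x \<in> carrier (fk_E n)"
    then show "\<exists>y\<in>carrier (fk_E n). y \<oplus>\<^bsub>fk_E n\<^esub> x = \<zero>\<^bsub>fk_E n\<^esub>"
      by (intro bexI[OF _ fk_uminus_E[of x]]) (simp_all add: fk_E_sel(2-) fk_add_def fk_zero_def)
  qed (simp_all add: fk_E_sel(2-) fk_E_add fk_zero_E fk_add_assoc fk_zero_add, rule fk_add_commute)
  show "monoid (fk_E n)"
    by (rule monoidI) (simp_all add: fk_E_sel(2-) fk_E_mult[OF n] fk_one_E fk_mult_assoc fk_one_mult fk_mult_one)
qed (simp_all add: fk_E_sel(2-) fk_distrib)

lemma formal_sum_nz: "formal_sum K f u \<noteq> 0 \<Longrightarrow> \<exists>k\<in>K. f k u \<noteq> 0"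
  unfolding formal_sum_def by (erule sum.not_neutral_contains_not_neutral) blast

lemma fk_summable_E:
  assumes f: "range f \<subseteq> carrier (fk_E n)" and s: "fk_summable n f"
  shows "formal_sum UNIV f \<in> carrier (fk_E n)"
proof -
  have nz: "\<exists>k. f k u \<noteq> 0" if "formal_sum UNIV f u \<noteq> 0" for u
    using formal_sum_nz[OF that] by blast
  have "formal_sum UNIV f \<in> fk_A n"
    using f nz by (fastforce simp: fk_A_def fk_E_sel)
  moreover have "finite {u. formal_sum UNIV f u \<noteq> 0 \<and> nc_act_word n u (frag_of w) \<noteq> 0}" if w: "w \<in> affine_sym n" for w
  proof (rule finite_subset)
    let ?K = "{k. \<exists>u. f k u \<noteq> 0 \<and> nc_act_word n u (frag_of w) \<noteq> 0}"
    let ?B = "\<Union>k\<in>?K. {u. f k u \<noteq> 0 \<and> nc_act_word n u (frag_of w) \<noteq> 0}"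
    show "{u. formal_sum UNIV f u \<noteq> 0 \<and> nc_act_word n u (frag_of w) \<noteq> 0} \<subseteq> ?B"
      using nz by blast
    show "finite ?B"
    proof (rule finite_UN_I)
      show "finite ?K" using s w by (simp add: fk_summable_def)
      fix k show "finite {u. f k u \<noteq> 0 \<and> nc_act_word n u (frag_of w) \<noteq> 0}"
        using f w by (auto simp: fk_E_sel)
    qed
  qed
  ultimately show ?thesis by (simp add: fk_E_sel)
qed

lemma ideal_fk_ideal:
  assumes n: "n > 0" and R: "R \<subseteq> carrier (fk_E n)"
  shows "ideal (fk_ideal n R) (fk_E n)" "R \<subseteq> fk_ideal n R"
    "\<And>f. range f \<subseteq> fk_ideal n R \<Longrightarrow> fk_summable n f \<Longrightarrow> formal_sum UNIV f \<in> fk_ideal n R"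
proof -
  interpret ring "fk_E n" by (rule ring_fk_E[OF n])
  show "ideal (fk_ideal n R) (fk_E n)" unfolding fk_ideal_def
  proof (rule i_Intersect)
    have "carrier (fk_E n) \<in> {I. ideal I (fk_E n) \<and> R \<subseteq> I \<and>
     (\<forall>f. range f \<subseteq> I \<and> fk_summable n f \<longrightarrow> formal_sum UNIV f \<in> I)}"
      using oneideal R fk_summable_E by auto
    then show "{I. ideal I (fk_E n) \<and> R \<subseteq> I \<and>
     (\<forall>f. range f \<subseteq> I \<and> fk_summable n f \<longrightarrow> formal_sum UNIV f \<in> I)} \<noteq> {}" by blast
  qed auto
  show "R \<subseteq> fk_ideal n R" by (auto simp: fk_ideal_def)
  show "formal_sum UNIV f \<in> fk_ideal n R" if "range f \<subseteq> fk_ideal n R" "fk_summable n f" for f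
    using that by (simp add: fk_ideal_def le_Inf_iff)
qed


lemma aff_refl_simple:
  assumes n: "n \<ge> 2" and k: "k \<in> {0..<int n}"
  shows "\<not> [k = k + 1] (mod int n)"
proof
  assume "[k = k + 1] (mod int n)"
  then have "int n dvd 1" by (metis cong_iff_dvd_diff add_diff_cancel_left' cong_sym)
  then show False using n by auto
qed

lemma quad_aux:
  fixes A B a b c :: int assumes "b = a + 1 - c" "B + c < A"
  shows "(B + c - a)^2 + (A - c - b)^2 < (A - a)^2 + (B - b)^2"
proof -
  have "(A - a)^2 + (B - b)^2 - ((B + c - a)^2 + (A - c - b)^2) = 2 * (A - B - c)"
    unfolding assms(1) by (simp add: power2_eq_square algebra_simps)
  moreover have "2 * (A - B - c) > 0" using assms(2) by simp
  ultimately show ?thesis by (metis diff_gt_0_iff_gt)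
qed

lemma aff_generated:
  assumes n: "n \<ge> 2"
  shows "w \<in> affine_sym n \<Longrightarrow> \<exists>ks. set ks \<subseteq> {0..<int n} \<and>
        w = foldr (\<lambda>k v. aff_refl n k (k + 1) \<circ> v) ks id"
proof (induction "nat (\<Sum>x=1..int n. (w x - x)^2)" arbitrary: w rule: less_induct)
  case less
  have bw: "bij w" and pw: "\<forall>i. w (i + int n) = w i + int n"
    and sw: "(\<Sum>i=1..int n. w i) = (\<Sum>i=1..int n. i)" using less.prems by (auto simp: affine_sym_def)
  have n0: "n > 0" using n by simp
  show ?case
  proof (cases "\<exists>a\<in>{1..int n}. w a > w (a + 1)")
    case True
    then obtain a where a: "a \<in> {1..int n}" "w a > w (a + 1)" by blast
    define k where "k = a mod int n"
    have k: "k \<in> {0..<int n}" using n by (simp add: k_def)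
    let ?s = "aff_refl n k (k + 1)"
    have seq: "?s = aff_refl n a (a + 1)"
      by (rule ext) (auto simp: aff_refl_def k_def cong_def mod_add_left_eq)
    let ?v = "w \<circ> ?s"
    have v: "?v \<in> affine_sym n" by (rule affine_sym_refl[OF n0 less.prems aff_refl_simple[OF n k]])
    define b where "b = (if a = int n then 1 else a + 1)"
    define e where "e = (if a = int n then 1 else 0 :: int)"
    have b: "b \<in> {1..int n}" "a + 1 = b + e * int n" "a \<noteq> b" using a n by (auto simp: b_def e_def)
    have sa: "?s a = b + e * int n" unfolding seq using b by (simp add: aff_refl_def)
    have sb: "?s b = a + (- e) * int n" unfolding seq
      using rep_cong_iff[OF b(1) a(1), of 0] rep_cong_iff[OF b(1) b(1), of e] b
      by (simp add: aff_refl_def)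
    have sx: "?s x = x" if "x \<in> {1..int n} - {a} - {b}" for x
      unfolding seq using that rep_cong_iff[of x n a 0] rep_cong_iff[of x n b e] a b
      by (simp add: aff_refl_def)
    have split: "sum f {1..int n} = f a + (f b + sum f ({1..int n} - {a} - {b}))" for f :: "int \<Rightarrow> int"
      using a(1) b(1,3) by (subst sum.remove[of _ a], simp_all, subst sum.remove[of _ b], auto)
    define c where "c = e * int n"
    have wab: "w (a + 1) = w b + c" using aff_shift_mult[OF pw, of b e] b c_def by simp
    have va: "?v a = w b + c" using aff_shift_mult[OF pw, of b e] by (simp add: sa c_def)
    have vb: "?v b = w a - c" using aff_shift_mult[OF pw, of a "-e"] sb by (simp add: c_def)
    have ba: "b = a + 1 - c" using b by (simp add: c_def)
    have "(\<Sum>x=1..int n. (?v x - x)^2) < (\<Sum>x=1..int n. (w x - x)^2)"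
    proof -
      have "(\<Sum>x\<in>{1..int n} - {a} - {b}. (?v x - x)^2) = (\<Sum>x\<in>{1..int n} - {a} - {b}. (w x - x)^2)"
        by (rule sum.cong) (use sx in auto)
      moreover have "(?v a - a)^2 + (?v b - b)^2 < (w a - a)^2 + (w b - b)^2"
        unfolding va vb using quad_aux[OF ba] a(2) wab by simp
      ultimately show ?thesis unfolding split[of "\<lambda>x. (?v x - x)^2"] split[of "\<lambda>x. (w x - x)^2"] by linarith
    qed
    moreover have "(\<Sum>x=1..int n. (?v x - x)^2) \<ge> 0" by (rule sum_nonneg) simp
    ultimately obtain ks where ks: "set ks \<subseteq> {0..<int n}" "?v = foldr (\<lambda>k v. aff_refl n k (k + 1) \<circ> v) ks id"
      using less.hyps[OF _ v] by (metis (no_types, lifting) nat_less_eq_zless)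
    have fo: "foldr (\<lambda>k v. aff_refl n k (k + 1) \<circ> v) ks g = foldr (\<lambda>k v. aff_refl n k (k + 1) \<circ> v) ks id \<circ> g" for g
      by (induction ks) (simp_all add: comp_assoc)
    have "?v \<circ> ?s = w" using aff_refl_invol[OF aff_refl_simple[OF n k]] by (auto simp: fun_eq_iff)
    then have "w = foldr (\<lambda>k v. aff_refl n k (k + 1) \<circ> v) (ks @ [k]) id"
      using fo[of ?s] ks(2) by simp
    then show ?thesis using ks(1) k by (intro exI[of _ "ks @ [k]"]) auto
  next
    case False
    have inc: "w x < w (x + 1)" for x
    proof -
      obtain a p where a: "a \<in> {1..int n}" "x = a + p * int n" using residue_rep[OF n0] .
      have "w a \<noteq> w (a + 1)" using bw by (metis bij_pointE less_add_one less_irrefl)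
      then have "w a < w (a + 1)" using False a by force
      then show ?thesis using aff_shift_mult[OF pw, of a p] aff_shift_mult[OF pw, of "a + 1" p] a(2)
        by (simp add: algebra_simps)
    qed
    have incm: "w x < w y" if "x < y" for x y
      using that by (induction y rule: int_gr_induct) (use inc in \<open>auto intro: less_trans\<close>)
    have step: "w (x + 1) = w x + 1" for x
    proof -
      obtain y where y: "w y = w x + 1" using bw by (metis bij_pointE)
      have "x < y" using y incm[of y x] by (metis less_add_one linorder_neqE less_asym less_irrefl)
      then show ?thesis using y inc[of x] incm[of "x + 1" y] by (cases "y = x + 1") auto
    qed
    have wx: "w x = x + w 0" for x
    proof (induction x rule: int_induct[where k = 0])
      case (step1 i) then show ?case using step[of i] by simp
    next
      case (step2 i) then show ?case using step[of "i - 1"] by simp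
    qed simp
    have "(\<Sum>x=1..int n. x + w 0) = (\<Sum>x=1..int n. x)" 
    proof -
      have "(\<Sum>x=1..int n. x + w 0) = (\<Sum>x=1..int n. w x)" by (rule sum.cong[OF refl]) (rule wx[symmetric])
      then show ?thesis using sw by (rule trans)
    qed
    then have w0: "w 0 = 0" using n by (simp add: sum.distrib)
    have "w = id"
    proof fix x show "w x = id x" using wx[of x] unfolding w0 by simp qed
    then show ?thesis by (intro exI[of _ "[]"]) auto
  qed
qed

lemma finite_aff_length:
  assumes n: "n \<ge> 2"
  shows "finite {w \<in> affine_sym n. aff_length n w = m}"
proof (rule finite_subset)
  let ?F = "\<lambda>ks. foldr (\<lambda>k v. aff_refl n k (k + 1) \<circ> v) ks (id :: int \<Rightarrow> int)"
  show "{w \<in> affine_sym n. aff_length n w = m} \<subseteq> ?F ` {ks. set ks \<subseteq> {0..<int n} \<and> length ks = m}"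
  proof
    fix w assume w: "w \<in> {w \<in> affine_sym n. aff_length n w = m}"
    then obtain ks where "set ks \<subseteq> {0..<int n}" "w = ?F ks" using aff_generated[OF n, of w] by blast
    then have "\<exists>m ks. length ks = m \<and> set ks \<subseteq> {0..<int n} \<and> w = ?F ks" by blast
    then have "\<exists>ks. length ks = aff_length n w \<and> set ks \<subseteq> {0..<int n} \<and> w = ?F ks"
      unfolding aff_length_def by (rule LeastI_ex)
    then show "w \<in> ?F ` {ks. set ks \<subseteq> {0..<int n} \<and> length ks = m}" using w by auto
  qed
  show "finite (?F ` {ks. set ks \<subseteq> {0..<int n} \<and> length ks = m})"
    by (intro finite_imageI finite_lists_length_eq) simp
qed

lemma aff_refl_comm: "\<not> [i = j] (mod int n) \<Longrightarrow> aff_refl n i j = aff_refl n j i"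
proof
  fix x assume "\<not> [i = j] (mod int n)"
  then have "\<not> ([x = i] (mod int n) \<and> [x = j] (mod int n))" by (meson cong_sym cong_trans)
  then show "aff_refl n i j x = aff_refl n j i x" by (auto simp: aff_refl_def)
qed

lemma finite_descents:
  assumes n: "n \<ge> 2" and w: "w \<in> affine_sym n"
  shows "finite {j. \<not> [j = i] (mod int n) \<and> aff_length n (w \<circ> aff_refl n i j) + 1 = aff_length n w}"
proof (rule finite_imageD)
  let ?J = "{j. \<not> [j = i] (mod int n) \<and> aff_length n (w \<circ> aff_refl n i j) + 1 = aff_length n w}"
  have "(\<lambda>j. w \<circ> aff_refl n i j) ` ?J \<subseteq> {v \<in> affine_sym n. aff_length n v = aff_length n w - 1}"
    using affine_sym_refl[OF _ w, of i] n by (auto simp: cong_sym_eq[of i])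
  then show "finite ((\<lambda>j. w \<circ> aff_refl n i j) ` ?J)" using finite_aff_length[OF n] finite_subset by blast
  have "inj w" using w by (simp add: affine_sym_def bij_def)
  moreover have "aff_refl n i j i = j" for j by (simp add: aff_refl_def)
  ultimately show "inj_on (\<lambda>j. w \<circ> aff_refl n i j) ?J"
    by (auto simp: inj_on_def fun_eq_iff) (metis injD)
qed

lemma br_nz: "br i j u \<noteq> 0 \<Longrightarrow> u = [(min i j, max i j)]"
proof (cases "i < j")
  case True assume "br i j u \<noteq> 0"
  then have "u = [(i, j)]" using True by (simp add: br_def split: if_splits)
  then show ?thesis using True by simp
next
  case False assume "br i j u \<noteq> 0"
  then have "u = [(j, i)]" using False by (simp add: br_def split: if_splits)
  then show ?thesis using False by simp
qed

lemma br_A: assumes a: "\<not> [i = j] (mod int n)" shows "br i j \<in> fk_A n"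
proof -
  have "i \<noteq> j" using a by auto
  moreover have "\<not> [j = i] (mod int n)" using a cong_sym by blast
  ultimately have "(min i j, max i j) \<in> fk_symbols n" using a
    by (cases "i < j") (simp_all add: fk_symbols_def)
  then show ?thesis using br_nz[of i j] unfolding fk_A_def by fastforce
qed

lemma br_E: assumes a: "\<not> [i = j] (mod int n)" shows "br i j \<in> carrier (fk_E n)"
proof (rule fk_finsupp_E[OF br_A[OF a]])
  have "{u. br i j u \<noteq> 0} \<subseteq> {[(min i j, max i j)]}" using br_nz[of i j] by auto
  then show "finite {u. br i j u \<noteq> 0}" by (rule finite_subset) simp
qed

lemma br_act: "br i j u \<noteq> 0 \<Longrightarrow> \<not> [i = j] (mod int n) \<Longrightarrow> nc_act_word n u (frag_of w) =
  (if aff_length n (w \<circ> aff_refl n i j) + 1 = aff_length n w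
   then frag_of (w \<circ> aff_refl n i j) else 0)"
proof -
  assume a: "br i j u \<noteq> 0" "\<not> [i = j] (mod int n)"
  show ?thesis
  proof (cases "i < j")
    case True
    then have "u = [(i, j)]" using a(1) by (auto simp: br_def split: if_splits)
    then show ?thesis by (simp add: nc_act_word_Cons)
  next
    case False
    then have "u = [(j, i)]" using a(1) by (auto simp: br_def split: if_splits)
    then show ?thesis unfolding aff_refl_comm[OF a(2)] by (simp add: nc_act_word_Cons)
  qed
qed


lemma dunkl_E: assumes n: "n \<ge> 2" shows "dunkl n i \<in> carrier (fk_E n)"
proof -
  have "dunkl n i \<in> fk_A n"
    using br_A[of i _ n] formal_sum_nz[of "{j. \<not> [j = i] (mod int n)}" "br i"] unfolding dunkl_def fk_A_def cong_sym_eq[of i]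
    by blast
  moreover have "finite {u. dunkl n i u \<noteq> 0 \<and> nc_act_word n u (frag_of w) \<noteq> 0}" if w: "w \<in> affine_sym n" for w
  proof (rule finite_subset)
    let ?J = "{j. \<not> [j = i] (mod int n) \<and> aff_length n (w \<circ> aff_refl n i j) + 1 = aff_length n w}"
    show "finite ((\<lambda>j. [(min i j, max i j)]) ` ?J)" using finite_descents[OF n w] by simp
    show "{u. dunkl n i u \<noteq> 0 \<and> nc_act_word n u (frag_of w) \<noteq> 0} \<subseteq> (\<lambda>j. [(min i j, max i j)]) ` ?J"
    proof
      fix u assume u: "u \<in> {u. dunkl n i u \<noteq> 0 \<and> nc_act_word n u (frag_of w) \<noteq> 0}"
      then obtain j where j: "\<not> [j = i] (mod int n)" "br i j u \<noteq> 0"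
        unfolding dunkl_def using formal_sum_nz by fastforce
      then show "u \<in> (\<lambda>j. [(min i j, max i j)]) ` ?J" using u br_nz[OF j(2)] br_act[OF j(2), of n w]
        unfolding cong_sym_eq[of i] by (auto split: if_splits)
    qed
  qed
  ultimately show ?thesis by (simp add: fk_E_sel)
qed

lemma fk_diff_E: "x \<in> carrier (fk_E n) \<Longrightarrow> y \<in> carrier (fk_E n) \<Longrightarrow> x -\<^sub>A y \<in> carrier (fk_E n)"
  using fk_E_add[of x n "\<lambda>u. - y u"] fk_uminus_E[of y n] by (simp add: fk_add_def fk_diff_def)

lemma br_self: "br i j [(min i j, max i j)] \<noteq> 0"
  by (cases "i < j") (simp_all add: br_def)

lemma rel_d_E:
  assumes n: "n \<ge> 2" and ij: "\<not> [i = j] (mod int n)"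
  shows "formal_sum {(i', j'). [i' = i] (mod int n) \<and> [j' = j] (mod int n)}
        (\<lambda>(i', j'). br i j' *\<^sub>A br j i') \<in> carrier (fk_E n)" (is "?x \<in> _")
proof -
  have xy: "dunkl n i *\<^sub>A dunkl n j \<in> carrier (fk_E n)" using fk_E_mult dunkl_E n by simp
  have dn: "dunkl n i [(min i j', max i j')] \<noteq> 0" if "\<not> [j' = i] (mod int n)" for i j'
  proof -
    have "{k. k \<in> {j. \<not> [j = i] (mod int n)} \<and> br i k [(min i j', max i j')] \<noteq> 0} = {j'}"
    proof -
      have "k = j'" if "br i k [(min i j', max i j')] \<noteq> 0" for k
        using br_nz[OF that] by (auto simp: min_def max_def split: if_splits)
      then show ?thesis using that br_self by auto
    qed
    then show ?thesis using br_self by (simp add: dunkl_def formal_sum_def)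
  qed
  have nz: "(dunkl n i *\<^sub>A dunkl n j) u \<noteq> 0" if u: "?x u \<noteq> 0" for u
  proof -
    obtain i' j' where h: "[i' = i] (mod int n)" "[j' = j] (mod int n)" "(br i j' *\<^sub>A br j i') u \<noteq> 0"
      using formal_sum_nz[OF u] by auto
    obtain p q where pq: "u = p @ q" "br i j' p \<noteq> 0" "br j i' q \<noteq> 0" using fk_mult_nz[OF h(3)] by blast
    let ?s = "(min i j', max i j')" and ?t = "(min j i', max j i')"
    have u2: "u = [?s, ?t]" using pq br_nz by auto
    have z: "dunkl n k [] = 0" "dunkl n k [s, t] = 0" for k s t
      using formal_sum_nz[of _ "br k"] br_nz unfolding dunkl_def by fastforce+
    have "(dunkl n i *\<^sub>A dunkl n j) u = dunkl n i [?s] * dunkl n j [?t]"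
      unfolding u2 fk_mult_def by (simp add: z atMost_Suc)
    moreover have "\<not> [j' = i] (mod int n)" "\<not> [i' = j] (mod int n)"
      using h ij by (meson cong_sym cong_trans)+
    ultimately show ?thesis using dn by simp
  qed
  have "?x \<in> fk_A n" using xy nz by (auto simp: fk_E_sel fk_A_def)
  moreover have "finite {u. ?x u \<noteq> 0 \<and> nc_act_word n u (frag_of w) \<noteq> 0}" if "w \<in> affine_sym n" for w
    by (rule finite_subset[of _ "{u. (dunkl n i *\<^sub>A dunkl n j) u \<noteq> 0 \<and> nc_act_word n u (frag_of w) \<noteq> 0}"])
       (use nz xy that in \<open>auto simp: fk_E_sel\<close>)
  ultimately show ?thesis by (simp add: fk_E_sel)
qed

lemma relators_E:
  assumes n: "n \<ge> 2"
  shows "fk_relators n \<union> fk_relators_printed n \<subseteq> carrier (fk_E n)"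
proof -
  have M: "x *\<^sub>A y \<in> carrier (fk_E n)" if "x \<in> carrier (fk_E n)" "y \<in> carrier (fk_E n)" for x y
    using fk_E_mult n that by simp
  have B: "br i j \<in> carrier (fk_E n)" if "i mod int n \<noteq> j mod int n" for i j
    using br_E that unfolding cong_def .
  note D = rel_d_E[OF n]
  have c: "fk_common_relators n \<subseteq> carrier (fk_E n)"
  proof
    fix x assume "x \<in> fk_common_relators n"
    then consider i j where "x = br i j *\<^sub>A br i j" "\<not> [i = j] (mod int n)"
      | i j k l where "x = br i j *\<^sub>A br k l -\<^sub>A br k l *\<^sub>A br i j" "distinct [i mod int n, j mod int n, k mod int n, l mod int n]"
      | i j k where "x = br i j *\<^sub>A br j k -\<^sub>A (br j k *\<^sub>A br i k +\<^sub>A br i k *\<^sub>A br i j)" "distinct [i mod int n, j mod int n, k mod int n]"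
      | i j where "x = formal_sum {(i', j'). [i' = i] (mod int n) \<and> [j' = j] (mod int n)}
        (\<lambda>(i', j'). br i j' *\<^sub>A br j i')" "\<not> [i = j] (mod int n)"
      | i j where "x = br i j -\<^sub>A br (i + int n) (j + int n)" "\<not> [i = j] (mod int n)"
      unfolding fk_common_relators_def by blast
    then show "x \<in> carrier (fk_E n)"
    proof cases
      case (4 i j) show ?thesis unfolding 4(1) by (rule D[OF 4(2)])
    next
      case (5 i j) 
      then have "i mod int n \<noteq> j mod int n" by (simp add: cong_def)
      then show ?thesis using 5(1) fk_diff_E[OF B[of i j] B[of "i + int n" "j + int n"]] by simp
    qed (simp_all add: M B fk_E_add fk_diff_E br_E)
  qed
  have "x \<in> carrier (fk_E n)" if h: "x \<in> fk_relators n" for x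
  proof (cases "x \<in> fk_common_relators n")
    case False
    then obtain i j k where "x = br j k *\<^sub>A br i j -\<^sub>A (br i k *\<^sub>A br j k +\<^sub>A br i j *\<^sub>A br i k)" "distinct [i mod int n, j mod int n, k mod int n]"
      using h unfolding fk_relators_def by blast
    then show ?thesis by (simp add: M B fk_E_add fk_diff_E)
  qed (use c in blast)
  moreover have "x \<in> carrier (fk_E n)" if h: "x \<in> fk_relators_printed n" for x
  proof (cases "x \<in> fk_common_relators n")
    case False
    then obtain i j k where "x = br j k *\<^sub>A br i j -\<^sub>A (br i k *\<^sub>A br j k +\<^sub>A br i k *\<^sub>A br i j)" "distinct [i mod int n, j mod int n, k mod int n]"
      using h unfolding fk_relators_printed_def by blast
    then show ?thesis by (simp add: M B fk_E_add fk_diff_E)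
  qed (use c in blast)
  ultimately show ?thesis by blast
qed

end

theory Submission
  imports Defs "HOL-Library.Countable"
begin

text \<open>
  Write \<open>X(a,b) = [ia][jb] - [jb][ia]\<close>, so that the commutator of the Dunkl elements is the sum of
  all \<open>X(a,b)\<close>. If \<open>i \<equiv> j\<close>, the two Dunkl elements agree by relation (e). Otherwise, the terms with
  \<open>i, j, a, b\<close> pairwise incongruent vanish by (b), and those with \<open>a \<equiv> j\<close>, \<open>b \<equiv> i\<close> sum to zero
  by (d), applied to \<open>(i,j)\<close> and to \<open>(j,i)\<close>. The remaining terms are grouped into triples indexed
  by the pairs \<open>a \<equiv> b\<close> incongruent to \<open>i\<close> and \<open>j\<close>:
  \<open>X(a,b) + X(j+a-b, b) + X(a, i+b-a)\<close>. By (e) every letter of such a triple may be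
  replaced by one with indices among \<open>i\<close>, \<open>j+a-b\<close>, \<open>a\<close>, and the triple becomes a difference of two
  instances of the first three-term relation. The second three-term relation in its mirror form is
  the first one with \<open>i\<close> and \<open>k\<close> exchanged, so only the relators common to both
  presentations are needed.
\<close>

section \<open>Summable families\<close>

text \<open>Allows subsets of an arbitrary index type: the families that occur are indexed by
  integers and by pairs of integers, while \<open>fk_summable\<close> speaks of sequences.\<close>

definition fk_summable_on :: "nat \<Rightarrow> 'k set \<Rightarrow> ('k \<Rightarrow> fk_elt) \<Rightarrow> bool" where
  "fk_summable_on n K f \<longleftrightarrow>
     (\<forall>u. finite {k \<in> K. f k u \<noteq> 0}) \<and>
     (\<forall>w \<in> affine_sym n. finite {k \<in> K. \<exists>u. f k u \<noteq> 0 \<and> nc_act_word n u (frag_of w) \<noteq> 0})"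

lemma fk_summable_on_finite: "fk_summable_on n K f \<Longrightarrow> finite {k \<in> K. f k u \<noteq> 0}"
  by (simp add: fk_summable_on_def)

text \<open>Summability concerns supports only; sums and differences of two families are the
  instances of interest.\<close>

lemma fk_summable_on_dominated:
  assumes f: "fk_summable_on n K f" and g: "fk_summable_on n K g"
    and h: "\<And>k u. k \<in> K \<Longrightarrow> h k u \<noteq> 0 \<Longrightarrow> f k u \<noteq> 0 \<or> g k u \<noteq> 0"
  shows "fk_summable_on n K h"
  unfolding fk_summable_on_def
proof (intro conjI allI ballI)
  fix u
  show "finite {k \<in> K. h k u \<noteq> 0}"
    by (rule finite_subset[of _ "{k \<in> K. f k u \<noteq> 0} \<union> {k \<in> K. g k u \<noteq> 0}"])
       (use h f g in \<open>auto simp: fk_summable_on_def\<close>)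
next
  fix w assume w: "w \<in> affine_sym n"
  let ?S = "\<lambda>f. {k \<in> K. \<exists>u. f k u \<noteq> 0 \<and> nc_act_word n u (frag_of w) \<noteq> 0}"
  show "finite (?S h)"
  proof (rule finite_subset)
    show "?S h \<subseteq> ?S f \<union> ?S g" using h by blast
    show "finite (?S f \<union> ?S g)" using f g w by (simp add: fk_summable_on_def)
  qed
qed

lemma fk_summable_on_add:
  assumes "fk_summable_on n K f" "fk_summable_on n K g"
  shows "fk_summable_on n K (\<lambda>k. f k +\<^sub>A g k)"
  by (rule fk_summable_on_dominated[OF assms]) (auto simp: fk_add_def)

lemma fk_summable_on_diff:
  assumes "fk_summable_on n K f" "fk_summable_on n K g"
  shows "fk_summable_on n K (\<lambda>k. f k -\<^sub>A g k)"
  by (rule fk_summable_on_dominated[OF assms]) (auto simp: fk_diff_def)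

text \<open>Injectivity keeps a single nonzero member from being repeated infinitely often.\<close>

lemma fk_summable_on_reindex:
  assumes "inj_on h L" "h ` L \<subseteq> K" "fk_summable_on n K f"
  shows "fk_summable_on n L (\<lambda>l. f (h l))"
proof -
  have "finite {l \<in> L. P (h l)}" if "finite {k \<in> K. P k}" for P
    by (rule inj_on_finite[OF _ _ that, of h])
       (use assms(1,2) in \<open>auto intro: inj_on_subset\<close>)
  from this[of "\<lambda>k. f k _ \<noteq> 0"]
    this[of "\<lambda>k. \<exists>u. f k u \<noteq> 0 \<and> nc_act_word n u (frag_of _) \<noteq> 0"]
  show ?thesis using assms(3) by (simp add: fk_summable_on_def)
qed

lemma fk_summable_on_subset:
  "fk_summable_on n K f \<Longrightarrow> L \<subseteq> K \<Longrightarrow> fk_summable_on n L f"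
  using fk_summable_on_reindex[of "\<lambda>k. k" L K n f] by simp

text \<open>For coefficients, a word has only finitely many factorisations. For the action on
  \<open>A_w\<close>, finitely many \<open>k\<close> act nontrivially, each through finitely many
  words \<open>p\<close>; such a \<open>p\<close> sends \<open>A_w\<close> to a basis element again,
  on which only finitely many \<open>g l\<close> act nontrivially.\<close>

lemma fk_summable_on_mult:
  assumes n: "n > 0"
    and f: "fk_summable_on n K f" "\<And>k. k \<in> K \<Longrightarrow> f k \<in> carrier (fk_E n)"
    and g: "fk_summable_on n L g"
  shows "fk_summable_on n (K \<times> L) (\<lambda>(k, l). f k *\<^sub>A g l)"
  unfolding fk_summable_on_def
proof (intro conjI allI ballI)
  fix u
  let ?B = "\<Union>m\<le>length u. {k \<in> K. f k (take m u) \<noteq> 0} \<times> {l \<in> L. g l (drop m u) \<noteq> 0}"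
  show "finite {p \<in> K \<times> L. (case p of (k, l) \<Rightarrow> f k *\<^sub>A g l) u \<noteq> 0}"
  proof (rule finite_subset)
    show "finite ?B" using f(1) g by (auto simp: fk_summable_on_def)
    show "{p \<in> K \<times> L. (case p of (k, l) \<Rightarrow> f k *\<^sub>A g l) u \<noteq> 0} \<subseteq> ?B"
    proof clarsimp
      fix k l assume kl: "k \<in> K" "l \<in> L" "(f k *\<^sub>A g l) u \<noteq> 0"
      then obtain p q where "u = p @ q" "f k p \<noteq> 0" "g l q \<noteq> 0" using fk_mult_nz by blast
      then show "\<exists>m\<in>{..length u}. f k (take m u) \<noteq> 0 \<and> g l (drop m u) \<noteq> 0"
        by (intro bexI[of _ "length p"]) auto
    qed
  qed
next
  fix w assume w: "w \<in> affine_sym n"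
  let ?K = "{k \<in> K. \<exists>p. f k p \<noteq> 0 \<and> nc_act_word n p (frag_of w) \<noteq> 0}"
  let ?P = "\<lambda>k. {p. f k p \<noteq> 0 \<and> nc_act_word n p (frag_of w) \<noteq> 0}"
  let ?L = "\<lambda>p. {l \<in> L. \<exists>q. g l q \<noteq> 0 \<and> nc_act_word n q (nc_act_word n p (frag_of w)) \<noteq> 0}"
  let ?B = "\<Union>k\<in>?K. \<Union>p\<in>?P k. {k} \<times> ?L p"
  show "finite {p \<in> K \<times> L. \<exists>u. (case p of (k, l) \<Rightarrow> f k *\<^sub>A g l) u \<noteq> 0 \<and> nc_act_word n u (frag_of w) \<noteq> 0}"
  proof (rule finite_subset)
    show "finite ?B"
    proof (intro finite_UN_I finite_cartesian_product finite.intros)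
      show "finite ?K" using f(1) w by (simp add: fk_summable_on_def)
      fix k assume k: "k \<in> ?K"
      then have kE: "f k \<in> carrier (fk_E n)" using f(2) by blast
      then show "finite (?P k)" using w by (simp add: fk_E_sel)
      fix p assume p: "p \<in> ?P k"
      then have "p \<in> lists (fk_symbols n)" using kE by (auto simp: fk_E_sel fk_A_def)
      then obtain w' where "w' \<in> affine_sym n" "nc_act_word n p (frag_of w) = frag_of w'"
        using nc_act_word_basis[OF n _ w] p by blast
      then show "finite (?L p)" using g by (simp add: fk_summable_on_def)
    qed
    show "{p \<in> K \<times> L. \<exists>u. (case p of (k, l) \<Rightarrow> f k *\<^sub>A g l) u \<noteq> 0 \<and> nc_act_word n u (frag_of w) \<noteq> 0} \<subseteq> ?B"
    proof clarify
      fix k l u assume kl: "k \<in> K" "l \<in> L" "(f k *\<^sub>A g l) u \<noteq> 0" "nc_act_word n u (frag_of w) \<noteq> 0"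
      then obtain p q where pq: "u = p @ q" "f k p \<noteq> 0" "g l q \<noteq> 0" using fk_mult_nz by blast
      then have "nc_act_word n q (nc_act_word n p (frag_of w)) \<noteq> 0"
        using kl(4) by (simp add: nc_act_word_append)
      moreover from this have "nc_act_word n p (frag_of w) \<noteq> 0" by auto
      ultimately show "(k, l) \<in> ?B" using pq kl by blast
    qed
  qed
qed

text \<open>A one-letter word leaves only its two ends as candidates for \<open>k\<close>, and
  \<open>finite_descents\<close> bounds the \<open>k\<close> for which [ik] acts nontrivially on
  \<open>A_w\<close>.\<close>

lemma fk_summable_on_dunkl:
  assumes n: "n \<ge> 2"
  shows "fk_summable_on n {k. \<not> [k = i] (mod int n)} (br i)"
  unfolding fk_summable_on_def
proof (intro conjI allI ballI)
  fix u
  have "k \<in> {fst (hd u), snd (hd u)}" if "br i k u \<noteq> 0" for k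
    using br_nz[OF that] by (simp add: min_def max_def)
  then have "{k \<in> {k. \<not> [k = i] (mod int n)}. br i k u \<noteq> 0} \<subseteq> {fst (hd u), snd (hd u)}"
    by blast
  then show "finite {k \<in> {k. \<not> [k = i] (mod int n)}. br i k u \<noteq> 0}"
    by (rule finite_subset) simp
next
  fix w assume w: "w \<in> affine_sym n"
  show "finite {k \<in> {k. \<not> [k = i] (mod int n)}. \<exists>u. br i k u \<noteq> 0 \<and> nc_act_word n u (frag_of w) \<noteq> 0}"
    by (rule finite_subset[OF _ finite_descents[OF n w, of i]])
       (auto simp: br_act cong_sym_eq[of i] split: if_splits)
qed

section \<open>Formal sums\<close>

text \<open>The index set inside \<open>formal_sum\<close> varies with the family and the word; a
  common finite \<open>B\<close> makes several formal sums comparable.\<close>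

lemma formal_sum_finite:
  assumes "finite B" "B \<subseteq> K" "\<And>k. k \<in> K \<Longrightarrow> f k u \<noteq> 0 \<Longrightarrow> k \<in> B"
  shows "formal_sum K f u = (\<Sum>k\<in>B. f k u)"
  unfolding formal_sum_def by (rule sum.mono_neutral_left) (use assms in auto)

lemma formal_sum_cong: "(\<And>k. k \<in> K \<Longrightarrow> f k = g k) \<Longrightarrow> formal_sum K f = formal_sum K g"
  unfolding formal_sum_def by (intro ext sum.cong) auto

lemma formal_sum_add:
  assumes "fk_summable_on n K f" "fk_summable_on n K g"
  shows "formal_sum K (\<lambda>k. f k +\<^sub>A g k) = formal_sum K f +\<^sub>A formal_sum K g"
proof
  fix u
  let ?B = "{k \<in> K. f k u \<noteq> 0} \<union> {k \<in> K. g k u \<noteq> 0}"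
  have B: "finite ?B" using assms by (simp add: fk_summable_on_finite)
  have "formal_sum K (\<lambda>k. f k +\<^sub>A g k) u = (\<Sum>k\<in>?B. (f k +\<^sub>A g k) u)"
    by (rule formal_sum_finite[OF B]) (auto simp: fk_add_def)
  moreover have "formal_sum K f u = (\<Sum>k\<in>?B. f k u)" by (rule formal_sum_finite[OF B]) auto
  moreover have "formal_sum K g u = (\<Sum>k\<in>?B. g k u)" by (rule formal_sum_finite[OF B]) auto
  ultimately show "formal_sum K (\<lambda>k. f k +\<^sub>A g k) u = (formal_sum K f +\<^sub>A formal_sum K g) u"
    by (simp add: fk_add_def sum.distrib)
qed

lemma formal_sum_diff:
  assumes "fk_summable_on n K f" "fk_summable_on n K g"
  shows "formal_sum K (\<lambda>k. f k -\<^sub>A g k) = formal_sum K f -\<^sub>A formal_sum K g"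
proof
  fix u
  \<comment> \<open>The difference is reduced to additivity by writing \<open>f\<close> as
    \<open>(f - g) + g\<close>.\<close>
  have "formal_sum K (\<lambda>k. (f k -\<^sub>A g k) +\<^sub>A g k) = formal_sum K (\<lambda>k. f k -\<^sub>A g k) +\<^sub>A formal_sum K g"
    by (rule formal_sum_add[OF fk_summable_on_diff[OF assms] assms(2)])
  moreover have "(f k -\<^sub>A g k) +\<^sub>A g k = f k" for k by (simp add: fk_add_def fk_diff_def)
  ultimately have "formal_sum K f = formal_sum K (\<lambda>k. f k -\<^sub>A g k) +\<^sub>A formal_sum K g" by simp
  then show "formal_sum K (\<lambda>k. f k -\<^sub>A g k) u = (formal_sum K f -\<^sub>A formal_sum K g) u"
    by (simp add: fk_add_def fk_diff_def)
qed

lemma formal_sum_Un_disjoint: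
  assumes "fk_summable_on n (K \<union> L) f" "K \<inter> L = {}"
  shows "formal_sum (K \<union> L) f = formal_sum K f +\<^sub>A formal_sum L f"
proof
  fix u
  let ?S = "\<lambda>K. {k. k \<in> K \<and> f k u \<noteq> 0}"
  have S: "?S (K \<union> L) = ?S K \<union> ?S L" by blast
  have "finite (?S K \<union> ?S L)" using fk_summable_on_finite[OF assms(1), of u] unfolding S .
  then have "sum (\<lambda>k. f k u) (?S K \<union> ?S L) = sum (\<lambda>k. f k u) (?S K) + sum (\<lambda>k. f k u) (?S L)"
    using assms(2) by (intro sum.union_disjoint) auto
  then show "formal_sum (K \<union> L) f u = (formal_sum K f +\<^sub>A formal_sum L f) u"
    unfolding formal_sum_def fk_add_def S .
qed

text \<open>At each word the bijection restricts to the supports; if these are infinite, both sums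
  take the default value 0.\<close>

lemma formal_sum_reindex:
  assumes "bij_betw h L K"
  shows "formal_sum K f = formal_sum L (\<lambda>l. f (h l))"
proof
  fix u
  have "bij_betw h {l \<in> L. f (h l) u \<noteq> 0} {k \<in> K. f k u \<noteq> 0}"
    using assms by (auto simp: bij_betw_def inj_on_def)
  from sum.reindex_bij_betw[OF this, of "\<lambda>k. f k u"]
  show "formal_sum K f u = formal_sum L (\<lambda>l. f (h l)) u" unfolding formal_sum_def by (rule sym)
qed

text \<open>At a fixed word only finitely many indices matter, so distributivity for finite sums
  applies.\<close>

lemma formal_sum_mult:
  assumes f: "fk_summable_on n K f" and g: "fk_summable_on n L g"
  shows "formal_sum K f *\<^sub>A formal_sum L g = formal_sum (K \<times> L) (\<lambda>(k, l). f k *\<^sub>A g l)"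
proof
  fix u
  \<comment> \<open>\<open>A\<close> and \<open>B\<close> collect the indices for all cuts of
    \<open>u\<close> at once. Being independent of the cut \<open>m\<close>, they allow the sum over
    \<open>m\<close> to be moved inside.\<close>
  define A where "A = (\<Union>m\<le>length u. {k \<in> K. f k (take m u) \<noteq> 0})"
  define B where "B = (\<Union>m\<le>length u. {l \<in> L. g l (drop m u) \<noteq> 0})"
  have fin: "finite A" "finite B"
    using f g by (auto simp: A_def B_def fk_summable_on_finite)
  have AK: "A \<subseteq> K" "B \<subseteq> L" by (auto simp: A_def B_def)
  have "(formal_sum K f *\<^sub>A formal_sum L g) u =
      (\<Sum>m\<le>length u. (\<Sum>k\<in>A. f k (take m u)) * (\<Sum>l\<in>B. g l (drop m u)))"
    unfolding fk_mult_def
  proof (rule sum.cong[OF refl])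
    fix m assume m: "m \<in> {..length u}"
    have "formal_sum K f (take m u) = (\<Sum>k\<in>A. f k (take m u))"
      by (rule formal_sum_finite[OF fin(1) AK(1)]) (use m in \<open>auto simp: A_def\<close>)
    moreover have "formal_sum L g (drop m u) = (\<Sum>l\<in>B. g l (drop m u))"
      by (rule formal_sum_finite[OF fin(2) AK(2)]) (use m in \<open>auto simp: B_def\<close>)
    ultimately show "formal_sum K f (take m u) * formal_sum L g (drop m u) =
        (\<Sum>k\<in>A. f k (take m u)) * (\<Sum>l\<in>B. g l (drop m u))" by simp
  qed
  also have "\<dots> = (\<Sum>m\<le>length u. \<Sum>(k,l)\<in>A \<times> B. f k (take m u) * g l (drop m u))"
    by (simp add: sum_product sum.cartesian_product)
  also have "\<dots> = (\<Sum>p\<in>A \<times> B. (case p of (k, l) \<Rightarrow> f k *\<^sub>A g l) u)"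
    by (subst sum.swap) (simp add: fk_mult_def case_prod_unfold)
  also have "\<dots> = formal_sum (K \<times> L) (\<lambda>(k, l). f k *\<^sub>A g l) u"
  proof (rule formal_sum_finite[symmetric])
    fix p assume p: "p \<in> K \<times> L" "(case p of (k, l) \<Rightarrow> f k *\<^sub>A g l) u \<noteq> 0"
    then obtain k l where kl: "p = (k, l)" "k \<in> K" "l \<in> L" "(f k *\<^sub>A g l) u \<noteq> 0" by auto
    then obtain v w where "u = v @ w" "f k v \<noteq> 0" "g l w \<noteq> 0" using fk_mult_nz by blast
    then have "k \<in> A" "l \<in> B" using kl unfolding A_def B_def
      by (auto intro!: bexI[of _ "length v"])
    then show "p \<in> A \<times> B" using kl by simp
  qed (use fin AK in auto)
  finally show "(formal_sum K f *\<^sub>A formal_sum L g) u = formal_sum (K \<times> L) (\<lambda>(k, l). f k *\<^sub>A g l) u" .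
qed

section \<open>Signs and differences in products\<close>

lemma fk_distrib_diff:
  "(x -\<^sub>A y) *\<^sub>A z = x *\<^sub>A z -\<^sub>A y *\<^sub>A z" "z *\<^sub>A (x -\<^sub>A y) = z *\<^sub>A x -\<^sub>A z *\<^sub>A y"
  by (simp_all add: fk_mult_def fk_diff_def sum_subtractf left_diff_distrib right_diff_distrib)

text \<open>On the diagonal the encoding breaks antisymmetry: \<open>br i i\<close> has coefficient
  -1 at the word \<open>[(i, i)]\<close>, so it is not its own negative.\<close>

lemma br_swap: "i \<noteq> j \<Longrightarrow> br j i = (\<lambda>u. - br i j u)"
  by (auto simp: br_def fun_eq_iff)

lemma fk_mult_uminus:
  "(\<lambda>u. - x u) *\<^sub>A y = (\<lambda>u. - (x *\<^sub>A y) u)" "x *\<^sub>A (\<lambda>u. - y u) = (\<lambda>u. - (x *\<^sub>A y) u)"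
  by (simp_all add: fk_mult_def sum_negf)

lemma fk_E_minus:
  assumes n: "n > 0" and x: "x \<in> carrier (fk_E n)" and y: "y \<in> carrier (fk_E n)"
  shows "x \<ominus>\<^bsub>fk_E n\<^esub> y = x -\<^sub>A y"
proof -
  interpret ring "fk_E n" by (rule ring_fk_E[OF n])
  have "\<ominus>\<^bsub>fk_E n\<^esub> y = (\<lambda>u. - y u)"
    by (rule minus_equality[OF _ y fk_uminus_E[OF y]])
       (simp add: fk_E_sel(2-) fk_add_def fk_zero_def)
  then show ?thesis by (simp add: a_minus_def fk_E_sel(2-) fk_add_def fk_diff_def)
qed

section \<open>The ideal of relations\<close>

text \<open>Asking only that \<open>R\<close> contain the common relators treats both presentations
  at once.\<close>

locale fk_relations =
  fixes n :: nat and R :: "fk_elt set"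
  assumes n2: "n \<ge> 2" and common: "fk_common_relators n \<subseteq> R" and R_E: "R \<subseteq> carrier (fk_E n)"
begin

lemma n0: "n > 0" using n2 by simp

sublocale E: ring "fk_E n" by (rule ring_fk_E[OF n0])

sublocale I: ideal "fk_ideal n R" "fk_E n" by (rule ideal_fk_ideal(1)[OF n0 R_E])

abbreviation "J \<equiv> fk_ideal n R"

lemma J_E: "x \<in> J \<Longrightarrow> x \<in> carrier (fk_E n)" using I.a_subset by blast

lemma J_zero: "fk_zero \<in> J" using I.zero_closed by (simp add: fk_E_sel(2-))

lemma J_add: "x \<in> J \<Longrightarrow> y \<in> J \<Longrightarrow> x +\<^sub>A y \<in> J"
  using I.a_closed by (simp add: fk_E_sel(2-))

lemma J_diff: "x \<in> J \<Longrightarrow> y \<in> J \<Longrightarrow> x -\<^sub>A y \<in> J"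
  by (metis I.a_closed I.a_inv_closed J_E a_minus_def fk_E_minus n0)

lemma J_mult_left: "x \<in> J \<Longrightarrow> a \<in> carrier (fk_E n) \<Longrightarrow> a *\<^sub>A x \<in> J"
  using I.I_l_closed by (simp add: fk_E_sel(2-))

lemma J_mult_right: "x \<in> J \<Longrightarrow> a \<in> carrier (fk_E n) \<Longrightarrow> x *\<^sub>A a \<in> J"
  using I.I_r_closed by (simp add: fk_E_sel(2-))

lemma common_J: "fk_common_relators n \<subseteq> J"
  using common ideal_fk_ideal(2)[OF n0 R_E] by (rule subset_trans)

lemma J_commute:
  assumes "distinct [i mod int n, j mod int n, k mod int n, l mod int n]"
  shows "br i j *\<^sub>A br k l -\<^sub>A br k l *\<^sub>A br i j \<in> J"
  \<comment> \<open>The unions nest to the left, so three \<open>UnI1\<close> followed by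
    \<open>UnI2\<close> select the second family.\<close>
  by (rule subsetD[OF common_J], unfold fk_common_relators_def,
      rule UnI1, rule UnI1, rule UnI1, rule UnI2) (use assms in blast)

lemma J_cyclic_sum:
  assumes "\<not> [i = j] (mod int n)"
  shows "formal_sum {(i', j'). [i' = i] (mod int n) \<and> [j' = j] (mod int n)}
      (\<lambda>(i', j'). br i j' *\<^sub>A br j i') \<in> J"
  by (rule subsetD[OF common_J], unfold fk_common_relators_def,
      rule UnI1, rule UnI2) (use assms in blast)

lemma J_formal_sum:
  fixes f :: "'k::countable \<Rightarrow> fk_elt"
  assumes s: "fk_summable_on n K f" and f: "\<And>k. k \<in> K \<Longrightarrow> f k \<in> J"
  shows "formal_sum K f \<in> J"
proof -
  define g where "g m = (if m \<in> to_nat ` K then f (from_nat m) else fk_zero)" for m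
  have g_nz: "m \<in> to_nat ` K" if "g m u \<noteq> 0" for m u
    using that by (auto simp: g_def fk_zero_def split: if_splits)
  have g_to_nat: "g (to_nat k) = f k" if "k \<in> K" for k using that by (simp add: g_def)
  have "range g \<subseteq> J" using f J_zero by (auto simp: g_def)
  moreover have "fk_summable n g"
    unfolding fk_summable_def
  proof (intro conjI allI ballI)
    fix u
    have "{m. g m u \<noteq> 0} \<subseteq> to_nat ` {k \<in> K. f k u \<noteq> 0}"
    proof clarify
      fix m assume m: "g m u \<noteq> 0"
      then obtain k where "k \<in> K" "m = to_nat k" using g_nz by blast
      then show "m \<in> to_nat ` {k \<in> K. f k u \<noteq> 0}" using m g_to_nat by auto
    qed
    then show "finite {m. g m u \<noteq> 0}"
      by (rule finite_subset) (simp add: fk_summable_on_finite[OF s])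
  next
    fix w assume w: "w \<in> affine_sym n"
    let ?S = "{k \<in> K. \<exists>u. f k u \<noteq> 0 \<and> nc_act_word n u (frag_of w) \<noteq> 0}"
    have "{m. \<exists>u. g m u \<noteq> 0 \<and> nc_act_word n u (frag_of w) \<noteq> 0} \<subseteq> to_nat ` ?S"
    proof clarify
      fix m u assume m: "g m u \<noteq> 0" "nc_act_word n u (frag_of w) \<noteq> 0"
      then obtain k where "k \<in> K" "m = to_nat k" using g_nz by blast
      then show "m \<in> to_nat ` ?S" using m g_to_nat by auto
    qed
    moreover have "finite ?S" using s w by (simp add: fk_summable_on_def)
    ultimately show "finite {m. \<exists>u. g m u \<noteq> 0 \<and> nc_act_word n u (frag_of w) \<noteq> 0}"
      by (meson finite_imageI finite_subset)
  qed
  ultimately have "formal_sum UNIV g \<in> J" by (rule ideal_fk_ideal(3)[OF n0 R_E])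
  moreover have "formal_sum UNIV g = formal_sum (to_nat ` K) g"
  proof
    fix u
    have "{m. m \<in> UNIV \<and> g m u \<noteq> 0} = {m. m \<in> to_nat ` K \<and> g m u \<noteq> 0}" using g_nz by blast
    then show "formal_sum UNIV g u = formal_sum (to_nat ` K) g u" unfolding formal_sum_def by metis
  qed
  moreover have "\<dots> = formal_sum K (\<lambda>k. g (to_nat k))"
    by (rule formal_sum_reindex) (simp add: bij_betw_def inj_on_def)
  moreover have "\<dots> = formal_sum K f" by (rule formal_sum_cong) (rule g_to_nat)
  ultimately show ?thesis by simp
qed

lemma coset_eqI:
  assumes "x \<in> carrier (fk_E n)" "y \<in> carrier (fk_E n)" "x -\<^sub>A y \<in> J"
  shows "J +>\<^bsub>fk_E n\<^esub> x = J +>\<^bsub>fk_E n\<^esub> y"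
  using E.quotient_eq_iff_same_a_r_cos[OF I.ideal_axioms assms(1,2)] assms(3)
  by (simp add: fk_E_minus[OF n0 assms(1,2)])

section \<open>Translation of symbols modulo the ideal\<close>

text \<open>The differences given by relation (e) telescope.\<close>

lemma br_shift_nat:
  assumes "\<not> [i = j] (mod int n)"
  shows "br i j -\<^sub>A br (i + int m * int n) (j + int m * int n) \<in> J"
proof (induction m)
  case 0
  have "br i j -\<^sub>A br i j = fk_zero" by (simp add: fk_diff_def fk_zero_def)
  then show ?case using J_zero by simp
next
  case (Suc m)
  let ?i = "i + int m * int n" and ?j = "j + int m * int n"
  have "\<not> [?i = ?j] (mod int n)" using assms by (simp add: cong_def)
  then have "br ?i ?j -\<^sub>A br (?i + int n) (?j + int n) \<in> J"
    using common_J unfolding fk_common_relators_def by blast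
  then have "(br i j -\<^sub>A br ?i ?j) +\<^sub>A (br ?i ?j -\<^sub>A br (?i + int n) (?j + int n)) \<in> J"
    using Suc J_add by blast
  then show ?case by (simp add: fk_add_def fk_diff_def algebra_simps)
qed

lemma br_shift:
  assumes ij: "\<not> [i = j] (mod int n)" and d: "i' - i = j' - j" "int n dvd i' - i"
  shows "br i j -\<^sub>A br i' j' \<in> J"
proof -
  obtain m where m: "i' = i + m * int n" using d(2) by (auto simp: dvd_def algebra_simps)
  have j: "j' = j + m * int n" using d(1) m by simp
  show ?thesis
  proof (cases "m \<ge> 0")
    case True
    then show ?thesis using br_shift_nat[OF ij, of "nat m"] m j by simp
  next
    case False
    have "\<not> [i' = j'] (mod int n)" using ij m j by (simp add: cong_def)
    \<comment> \<open>For negative \<open>m\<close> the forward translation leads from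
      \<open>(i', j')\<close> back to \<open>(i, j)\<close>; the sign is corrected afterwards by
      subtracting from zero.\<close>
    from br_shift_nat[OF this, of "nat (- m)"] have "br i' j' -\<^sub>A br i j \<in> J"
      using False m j by simp
    then have "fk_zero -\<^sub>A (br i' j' -\<^sub>A br i j) \<in> J" by (rule J_diff[OF J_zero])
    then show ?thesis by (simp add: fk_diff_def fk_zero_def)
  qed
qed

text \<open>Translation by \<open>j - i\<close> matches the summands of the two Dunkl elements. Each
  difference lies in the ideal by (e), and their infinite sum does so by closure under summable
  sums.\<close>

lemma dunkl_class_cong:
  assumes "[i = j] (mod int n)"
  shows "dunkl_class n R i = dunkl_class n R j"
  unfolding dunkl_class_def
proof (rule coset_eqI[OF dunkl_E[OF n2] dunkl_E[OF n2]])
  let ?K = "{k. \<not> [k = i] (mod int n)}" and ?L = "{k. \<not> [k = j] (mod int n)}"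
  have d: "int n dvd j - i" using assms by (simp add: cong_iff_dvd_diff dvd_diff_commute)
  have shift: "[k + (j - i) = j] (mod int n) \<longleftrightarrow> [k = i] (mod int n)" for k
    by (simp add: cong_iff_dvd_diff algebra_simps)
  have b: "bij_betw (\<lambda>k. k + (j - i)) ?K ?L"
    by (rule bij_betw_byWitness[where f' = "\<lambda>k. k - (j - i)"])
       (use shift in \<open>auto simp: cong_iff_dvd_diff algebra_simps\<close>)
  have s: "fk_summable_on n ?K (br i)" by (rule fk_summable_on_dunkl[OF n2])
  have s': "fk_summable_on n ?K (\<lambda>k. br j (k + (j - i)))"
    by (rule fk_summable_on_reindex[OF _ _ fk_summable_on_dunkl[OF n2, of j]])
       (use b in \<open>auto simp: bij_betw_def\<close>)
  have "dunkl n i -\<^sub>A dunkl n j = formal_sum ?K (\<lambda>k. br i k -\<^sub>A br j (k + (j - i)))"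
    unfolding dunkl_def formal_sum_reindex[OF b] formal_sum_diff[OF s s'] ..
  also have "\<dots> \<in> J"
    by (rule J_formal_sum[OF fk_summable_on_diff[OF s s'] br_shift])
       (use d in \<open>auto simp: cong_sym_eq[of i]\<close>)
  finally show "dunkl n i -\<^sub>A dunkl n j \<in> J" .
qed

section \<open>The commutator, term by term\<close>

definition comm_term :: "int \<Rightarrow> int \<Rightarrow> int \<times> int \<Rightarrow> fk_elt" where
  "comm_term i j = (\<lambda>(a, b). br i a *\<^sub>A br j b -\<^sub>A br j b *\<^sub>A br i a)"

lemma comm_term_triple:
  assumes ij: "\<not> [i = j] (mod int n)" and ai: "\<not> [a = i] (mod int n)"
    and aj: "\<not> [a = j] (mod int n)" and ab: "[a = b] (mod int n)"
  shows "comm_term i j (a, b) +\<^sub>A comm_term i j (j + a - b, b) +\<^sub>A comm_term i j (a, i + b - a) \<in> J"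
proof -
  \<comment> \<open>Translation by \<open>a - b\<close>, a multiple of \<open>n\<close>, takes [j,b]
    to [j',a] and [j,i+b-a] to [j',i]; \<open>e\<close> and \<open>e'\<close> are the errors of
    these replacements.\<close>
  define j' where "j' = j + a - b"
  define e where "e = br j b -\<^sub>A br j' a"
  define e' where "e' = br j (i + b - a) -\<^sub>A br j' i"
  have d: "int n dvd a - b" using ab by (simp add: cong_iff_dvd_diff)
  have jj: "[j' = j] (mod int n)" using d by (simp add: j'_def cong_iff_dvd_diff)
  have ij': "\<not> [i = j'] (mod int n)" and aj': "\<not> [a = j'] (mod int n)"
    using ij aj jj by (meson cong_trans)+
  have dis: "distinct [i mod int n, j' mod int n, a mod int n]"
    "distinct [a mod int n, j' mod int n, i mod int n]"
    using ij' aj' ai unfolding cong_def by auto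
  have e: "e \<in> J" unfolding e_def
    by (rule br_shift) (use d ab aj in \<open>auto simp: j'_def cong_def\<close>)
  have jib: "\<not> [j = i + b - a] (mod int n)"
  proof -
    have "[i + b - a = i] (mod int n)" using d by (simp add: cong_iff_dvd_diff dvd_diff_commute)
    then show ?thesis using ij by (meson cong_sym cong_trans)
  qed
  have e': "e' \<in> J" unfolding e'_def
    by (rule br_shift[OF jib]) (use d in \<open>auto simp: j'_def\<close>)
  \<comment> \<open>\<open>c\<close> is the first three-term relator. Its instance at
    \<open>(a, j', i)\<close> is the mirror image of the one at \<open>(i, j', a)\<close>, up to
    signs of letters.\<close>
  define c where "c = (\<lambda>i j k. br i j *\<^sub>A br j k -\<^sub>A (br j k *\<^sub>A br i k +\<^sub>A br i k *\<^sub>A br i j))"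
  have c: "c i j' a \<in> J" "c a j' i \<in> J"
    using common_J dis unfolding c_def fk_common_relators_def by blast+
  have E: "br i a \<in> carrier (fk_E n)" "br i j' \<in> carrier (fk_E n)"
    using br_E ij' ai by (auto simp: cong_sym_eq[of i])
  have ne: "i \<noteq> j'" "i \<noteq> a" "j' \<noteq> a" using ij' ai aj' by auto
  \<comment> \<open>With [jb] and [j,i+b-a] replaced by their translates, the triple is exactly
    \<open>c i j' a - c a j' i\<close>; the commutators of [ia] and [ij'] with \<open>e\<close>, and
    of [ia] with \<open>e'\<close>, restore the original letters.\<close>
  have "(br i a *\<^sub>A e -\<^sub>A e *\<^sub>A br i a) +\<^sub>A (br i j' *\<^sub>A e -\<^sub>A e *\<^sub>A br i j')
      +\<^sub>A (br i a *\<^sub>A e' -\<^sub>A e' *\<^sub>A br i a) +\<^sub>A (c i j' a -\<^sub>A c a j' i) \<in> J"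
    by (intro J_add J_diff J_mult_left J_mult_right e e' c E)
  also have "(br i a *\<^sub>A e -\<^sub>A e *\<^sub>A br i a) +\<^sub>A (br i j' *\<^sub>A e -\<^sub>A e *\<^sub>A br i j')
      +\<^sub>A (br i a *\<^sub>A e' -\<^sub>A e' *\<^sub>A br i a) +\<^sub>A (c i j' a -\<^sub>A c a j' i) =
    comm_term i j (a, b) +\<^sub>A comm_term i j (j', b) +\<^sub>A comm_term i j (a, i + b - a)"
    unfolding comm_term_def e_def e'_def c_def fk_distrib_diff
      br_swap[OF ne(1)] br_swap[OF ne(2)] br_swap[OF ne(3)] fk_mult_uminus prod.case
    by (simp add: fk_add_def fk_diff_def fun_eq_iff fk_mult_uminus)
  finally show ?thesis unfolding j'_def .
qed

text \<open>The family of all \<open>comm_term i j (a, b)\<close> is summable, hence so is each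
  subfamily. This justifies cutting the commutator into pieces by residue classes and reindexing
  them separately.\<close>

lemma dunkl_commutator:
  assumes ij: "\<not> [i = j] (mod int n)"
  shows "dunkl n i *\<^sub>A dunkl n j -\<^sub>A dunkl n j *\<^sub>A dunkl n i \<in> J"
proof -
  let ?eq = "\<lambda>x y. [x = y] (mod int n)"
  let ?X = "comm_term i j"
  define A where "A = {a. \<not> ?eq a i}"
  define B where "B = {b. \<not> ?eq b j}"
  have sA: "fk_summable_on n A (br i)" and sB: "fk_summable_on n B (br j)"
    unfolding A_def B_def by (rule fk_summable_on_dunkl[OF n2])+
  have AE: "br i a \<in> carrier (fk_E n)" if "a \<in> A" for a
    using that br_E by (simp add: A_def cong_sym_eq[of i])
  have BE: "br j b \<in> carrier (fk_E n)" if "b \<in> B" for b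
    using that br_E by (simp add: B_def cong_sym_eq[of j])
  have s1: "fk_summable_on n (A \<times> B) (\<lambda>(a, b). br i a *\<^sub>A br j b)"
    by (rule fk_summable_on_mult[OF n0 sA AE sB])
  have swap: "bij_betw prod.swap (A \<times> B) (B \<times> A)"
    by (rule bij_betw_byWitness[where f' = prod.swap]) auto
  have s2': "fk_summable_on n (B \<times> A) (\<lambda>(b, a). br j b *\<^sub>A br i a)"
    by (rule fk_summable_on_mult[OF n0 sB BE sA])
  have sw: "(case prod.swap p of (b, a) \<Rightarrow> br j b *\<^sub>A br i a) = (case p of (a, b) \<Rightarrow> br j b *\<^sub>A br i a)" for p
    by (cases p) simp
  have s2: "fk_summable_on n (A \<times> B) (\<lambda>(a, b). br j b *\<^sub>A br i a)"
    using fk_summable_on_reindex[OF _ _ s2', of prod.swap "A \<times> B"] swap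
    unfolding sw bij_betw_def by simp
  have X: "?X = (\<lambda>p. (case p of (a, b) \<Rightarrow> br i a *\<^sub>A br j b) -\<^sub>A (case p of (a, b) \<Rightarrow> br j b *\<^sub>A br i a))"
    by (auto simp: comm_term_def)
  have sX: "fk_summable_on n (A \<times> B) ?X" unfolding X by (rule fk_summable_on_diff[OF s1 s2])
  have D: "dunkl n i *\<^sub>A dunkl n j -\<^sub>A dunkl n j *\<^sub>A dunkl n i = formal_sum (A \<times> B) ?X"
  proof -
    have "dunkl n i *\<^sub>A dunkl n j = formal_sum (A \<times> B) (\<lambda>(a, b). br i a *\<^sub>A br j b)"
      unfolding dunkl_def A_def[symmetric] B_def[symmetric] by (rule formal_sum_mult[OF sA sB])
    moreover have "dunkl n j *\<^sub>A dunkl n i = formal_sum (B \<times> A) (\<lambda>(b, a). br j b *\<^sub>A br i a)"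
      unfolding dunkl_def A_def[symmetric] B_def[symmetric] by (rule formal_sum_mult[OF sB sA])
    moreover have "\<dots> = formal_sum (A \<times> B) (\<lambda>(a, b). br j b *\<^sub>A br i a)"
      unfolding formal_sum_reindex[OF swap] sw ..
    ultimately show ?thesis unfolding X formal_sum_diff[OF s1 s2] by simp
  qed

  \<comment> \<open>A case split on the residues of \<open>a\<close> and \<open>b\<close>: relation
    (b) handles \<open>K1\<close>, relation (d) handles \<open>K2\<close>, and \<open>K3\<close>
    indexes the triples, whose other two members lie in \<open>K4\<close> and
    \<open>K5\<close>.\<close>
  define K1 where "K1 = {(a, b). \<not> ?eq a i \<and> \<not> ?eq a j \<and> \<not> ?eq b i \<and> \<not> ?eq b j \<and> \<not> ?eq a b}"
  define K2 where "K2 = {(a, b). ?eq a j \<and> ?eq b i}"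
  define K3 where "K3 = {(a, b). \<not> ?eq a i \<and> \<not> ?eq a j \<and> ?eq a b}"
  define K4 where "K4 = {(a, b). ?eq a j \<and> \<not> ?eq b i \<and> \<not> ?eq b j}"
  define K5 where "K5 = {(a, b). \<not> ?eq a i \<and> \<not> ?eq a j \<and> ?eq b i}"
  have K: "A \<times> B = K1 \<union> (K2 \<union> (K3 \<union> (K4 \<union> K5)))"
    using ij unfolding A_def B_def K1_def K2_def K3_def K4_def K5_def cong_def by auto
  have dj: "K1 \<inter> (K2 \<union> (K3 \<union> (K4 \<union> K5))) = {}" "K2 \<inter> (K3 \<union> (K4 \<union> K5)) = {}"
    "K3 \<inter> (K4 \<union> K5) = {}" "K4 \<inter> K5 = {}"
    using ij unfolding K1_def K2_def K3_def K4_def K5_def cong_def by auto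
  have s: "fk_summable_on n L ?X" if "L \<subseteq> A \<times> B" for L
    by (rule fk_summable_on_subset[OF sX that])
  have split: "formal_sum (A \<times> B) ?X = formal_sum K1 ?X +\<^sub>A (formal_sum K2 ?X +\<^sub>A
      (formal_sum K3 ?X +\<^sub>A (formal_sum K4 ?X +\<^sub>A formal_sum K5 ?X)))"
    unfolding K
    by (subst formal_sum_Un_disjoint[OF s dj(1)], use K in blast,
        subst formal_sum_Un_disjoint[OF s dj(2)], use K in blast,
        subst formal_sum_Un_disjoint[OF s dj(3)], use K in blast,
        subst formal_sum_Un_disjoint[OF s dj(4)], use K in blast) simp

  have J1: "formal_sum K1 ?X \<in> J"
  proof (rule J_formal_sum[OF s])
    show "K1 \<subseteq> A \<times> B" using K by blast
    fix p assume p: "p \<in> K1"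
    obtain a b where ab: "p = (a, b)" by (cases p)
    have "distinct [i mod int n, a mod int n, j mod int n, b mod int n]"
      using p ij unfolding ab K1_def cong_def by auto
    from J_commute[OF this] show "?X p \<in> J" by (simp add: ab comm_term_def)
  qed

  have J2: "formal_sum K2 ?X \<in> J"
  proof -
    have sub: "K2 \<subseteq> A \<times> B" using K by blast
    let ?S = "{(i', j'). ?eq i' i \<and> ?eq j' j}"
    have ji: "\<not> ?eq j i" using ij cong_sym by blast
    \<comment> \<open>\<open>K2\<close> is already the index set of relation (d) for
      \<open>(j, i)\<close>; for \<open>(i, j)\<close> the two coordinates have to be
      swapped.\<close>
    have r2: "formal_sum K2 (\<lambda>(a, b). br j b *\<^sub>A br i a) \<in> J"
      unfolding K2_def by (rule J_cyclic_sum[OF ji])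
    have b: "bij_betw prod.swap K2 ?S"
      by (rule bij_betw_byWitness[where f' = prod.swap]) (auto simp: K2_def)
    have sw: "(case prod.swap p of (i', j') \<Rightarrow> br i j' *\<^sub>A br j i') = (case p of (a, b) \<Rightarrow> br i a *\<^sub>A br j b)" for p
      by (cases p) simp
    have r1: "formal_sum K2 (\<lambda>(a, b). br i a *\<^sub>A br j b) \<in> J"
      using J_cyclic_sum[OF ij] unfolding formal_sum_reindex[OF b] sw .
    have "formal_sum K2 ?X = formal_sum K2 (\<lambda>(a, b). br i a *\<^sub>A br j b) -\<^sub>A formal_sum K2 (\<lambda>(a, b). br j b *\<^sub>A br i a)"
      unfolding X by (rule formal_sum_diff) (rule fk_summable_on_subset[OF _ sub], fact)+
    then show ?thesis using J_diff[OF r1 r2] by simp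
  qed

  have J3: "formal_sum K3 ?X +\<^sub>A (formal_sum K4 ?X +\<^sub>A formal_sum K5 ?X) \<in> J"
  proof -
    \<comment> \<open>These maps send the first member of a triple to the second and third. As
      bijections onto \<open>K4\<close> and \<open>K5\<close> they ensure that every remaining term
      is used exactly once.\<close>
    let ?g = "\<lambda>(a, b). (j + a - b, b)" and ?h = "\<lambda>(a, b). (a, i + b - a)"
    have g: "bij_betw ?g K3 K4"
    proof (rule bij_betw_byWitness[where f' = "\<lambda>(a, b). (a + b - j, b)"])
      have 1: "?eq (j + a - b) j \<longleftrightarrow> ?eq a b" for a b
        by (simp add: cong_iff_dvd_diff)
      have 2: "?eq (a + b - j) b \<longleftrightarrow> ?eq a j" for a b
        by (simp add: cong_iff_dvd_diff)
      show "?g ` K3 \<subseteq> K4" unfolding K3_def K4_def using 1 by (auto simp: cong_def)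
      have 3: "(a + b - j, b) \<in> K3" if "?eq a j" "\<not> ?eq b i" "\<not> ?eq b j" for a b
      proof -
        have "?eq (a + b - j) b" using 2 that by blast
        then show ?thesis using that unfolding K3_def by (auto simp: cong_def)
      qed
      then show "(\<lambda>(a, b). (a + b - j, b)) ` K4 \<subseteq> K3" unfolding K4_def by auto
    qed auto
    have h: "bij_betw ?h K3 K5"
    proof (rule bij_betw_byWitness[where f' = "\<lambda>(a, b). (a, a + b - i)"])
      have "?eq (i + b - a) i \<longleftrightarrow> ?eq a b" for a b
        by (simp add: cong_iff_dvd_diff dvd_diff_commute)
      then show "?h ` K3 \<subseteq> K5" unfolding K3_def K5_def by auto
      have "?eq a (a + b - i) \<longleftrightarrow> ?eq b i" for a b
        by (simp add: cong_iff_dvd_diff dvd_diff_commute)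
      then show "(\<lambda>(a, b). (a, a + b - i)) ` K5 \<subseteq> K3" unfolding K3_def K5_def by auto
    qed auto
    have s3: "fk_summable_on n K3 ?X" using s K by blast
    have s4: "fk_summable_on n K3 (\<lambda>p. ?X (?g p))"
      by (rule fk_summable_on_reindex[of ?g _ K4]) (use g s K in \<open>auto simp: bij_betw_def\<close>)
    have s5: "fk_summable_on n K3 (\<lambda>p. ?X (?h p))"
      by (rule fk_summable_on_reindex[of ?h _ K5]) (use h s K in \<open>auto simp: bij_betw_def\<close>)
    note s34 = fk_summable_on_add[OF s3 s4]
    have "formal_sum K3 (\<lambda>p. ?X p +\<^sub>A ?X (?g p) +\<^sub>A ?X (?h p)) \<in> J"
    proof (rule J_formal_sum[OF fk_summable_on_add[OF s34 s5]])
      fix p assume p: "p \<in> K3"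
      then obtain a b where "p = (a, b)" "\<not> ?eq a i" "\<not> ?eq a j" "?eq a b" by (auto simp: K3_def)
      then show "?X p +\<^sub>A ?X (?g p) +\<^sub>A ?X (?h p) \<in> J" using comm_term_triple[OF ij] by simp
    qed
    then show ?thesis
      unfolding formal_sum_add[OF s34 s5] formal_sum_add[OF s3 s4]
        formal_sum_reindex[OF g] formal_sum_reindex[OF h]
      unfolding fk_add_assoc .
  qed
  show ?thesis unfolding D split by (intro J_add J1 J2 J3)
qed

end

section \<open>Passage to the quotient\<close>

theorem theorem4p2:
  fixes n :: nat and R :: "fk_elt set" and i j :: int
  assumes "n \<ge> 2"
    and "R \<in> {fk_relators n, fk_relators_printed n}"
  shows "dunkl_class n R i \<otimes>\<^bsub>FK n R\<^esub> dunkl_class n R j =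
         dunkl_class n R j \<otimes>\<^bsub>FK n R\<^esub> dunkl_class n R i"
proof -
  interpret fk_relations n R
  proof
    show "fk_common_relators n \<subseteq> R"
      using assms(2) by (auto simp: fk_relators_def fk_relators_printed_def)
    show "R \<subseteq> carrier (fk_E n)" using assms(2) relators_E[OF assms(1)] by auto
  qed (rule assms(1))
  show ?thesis
  proof (cases "[i = j] (mod int n)")
    case True
    then show ?thesis by (simp add: dunkl_class_cong)
  next
    case False
    have "dunkl_class n R k \<otimes>\<^bsub>FK n R\<^esub> dunkl_class n R l = J +>\<^bsub>fk_E n\<^esub> (dunkl n k *\<^sub>A dunkl n l)" for k l
      using I.rcoset_mult_add[OF dunkl_E[OF n2] dunkl_E[OF n2], of k l]
      by (simp add: FK_def FactRing_def dunkl_class_def fk_E_sel(2-))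
    moreover have "J +>\<^bsub>fk_E n\<^esub> (dunkl n i *\<^sub>A dunkl n j) = J +>\<^bsub>fk_E n\<^esub> (dunkl n j *\<^sub>A dunkl n i)"
      by (rule coset_eqI[OF _ _ dunkl_commutator[OF False]]) (intro fk_E_mult n0 dunkl_E n2)+
    ultimately show ?thesis by simp
  qed
qed

end
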